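(* Let $\zeta\in\mathbb{C}$ with $\zeta^3=1$, $\zeta\ne1$, and consider the polynomial system on $\mathbb{C}^3$ $$\dot x_1 = x_1+\sum_{(p,q,r)\in S}a_{pqr}x_1^{p+1}x_2^{q}x_3^{r},\qquad \dot x_2=\zeta\Big(x_2+\sum_{(p,q,r)\in S}b_{rpq}x_1^{r}x_2^{p+1}x_3^{q}\Big),\qquad \dot x_3=\zeta^2\Big(x_3+\sum_{(p,q,r)\in S}c_{qrp}x_1^{q}x_2^{r}x_3^{p+1}\Big),$$ where $S\subset\mathbb{N}_{-1}\times\mathbb{N}_0\times\mathbb{N}_0$ is a finite set of triples with $p+q+r\ge1$ for every $(p,q,r)\in S$, and the coefficients $a_{pqr},b_{rpq},c_{qrp}$ are complex numbers. Let $$\dot y_1=y_1+y_1Y_1(y_1y_2y_3),\qquad \dot y_2=\zeta y_2+y_2Y_2(y_1y_2y_3),\qquad \dot y_3=\zeta^2y_3+y_3Y_3(y_1y_2y_3)$$ be its distinguished normal form, where $Y_1,Y_2,Y_3$ are formal power series in one variable without constant term. If $Y_1+Y_2+Y_3\equiv0$, then the distinguished normal form is convergent.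
   Context: $\mathbb{N}_0=\{0,1,2,\dots\}$ and $\mathbb{N}_{-1}=\mathbb{N}_0\cup\{-1\}$. Consider a system $\dot x=Ax+X(x)$, $x\in\mathbb{C}^n$, with $A=\mathrm{diag}(\lambda_1,\dots,\lambda_n)$ and $X$ starting with terms of degree at least two. A monomial $x^\alpha=x_1^{\alpha_1}\cdots x_n^{\alpha_n}$, $\alpha\in\mathbb{N}_0^n$, $|\alpha|=\alpha_1+\cdots+\alpha_n\ge2$, in the $k$-th component of a vector of power series is called resonant if $\alpha_1\lambda_1+\cdots+\alpha_n\lambda_n-\lambda_k=0$, and non-resonant otherwise. A formal change of coordinates $x=y+h(y)$, with $h$ a vector of formal power series starting with terms of degree at least two, is a normalizing transformation if the transformed system $\dot y=Ay+G(y)$ is such that $G$ contains only resonant terms; the transformed system is then a (Poincaré–Dulac) normal form. The normalizing transformation for which $h$ contains only non-resonant terms is unique; it is called the distinguished normalizing transformation, and the corresponding normal form is the distinguished normal form. For the system in the claim $(\lambda_1,\lambda_2,\lambda_3)=(1,\zeta,\zeta^2)$, and every normal form has the displayed shape, with $Y_1(w)=\sum_{k\ge1}Y_1^{(k+1,k,k)}w^k$, $Y_2(w)=\sum_{k\ge1}Y_2^{(k,k+1,k)}w^k$, $Y_3(w)=\sum_{k\ge1}Y_3^{(k,k,k+1)}w^k$. "Convergent" means that the power series involved converge in a neighbourhood of the origin. *)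

theory Defs
  imports "HOL-Analysis.Analysis"
begin

section \<open>Formal power series in finitely many variables\<close>

text \<open>
  Formal power series over the complex numbers in variables indexed by a finite type \<open>'n\<close>;
  an exponent \<open>\<alpha>\<close> is a vector of type \<open>nat ^ 'n\<close>.
\<close>

typedef 'n mfps = "UNIV :: (nat ^ 'n \<Rightarrow> complex) set"
  morphisms mfps_nth Abs_mfps ..

setup_lifting type_definition_mfps

lemma mfps_eqI: "(\<And>\<alpha>. mfps_nth f \<alpha> = mfps_nth g \<alpha>) \<Longrightarrow> f = g"
  by (metis ext mfps_nth_inject)

definition mdeg :: "nat ^ 'n::finite \<Rightarrow> nat" where
  "mdeg \<alpha> = (\<Sum>i\<in>UNIV. \<alpha> $ i)"

lemma finite_exponents_le: "finite {\<beta> :: nat ^ 'n::finite. \<forall>i. \<beta> $ i \<le> m i}"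
proof (rule finite_imageD)
  have "vec_nth ` {\<beta> :: nat ^ 'n. \<forall>i. \<beta> $ i \<le> m i} \<subseteq> PiE UNIV (\<lambda>i. {..m i})"
    by auto
  then show "finite (vec_nth ` {\<beta> :: nat ^ 'n. \<forall>i. \<beta> $ i \<le> m i})"
    by (rule finite_subset) (auto intro: finite_PiE)
  show "inj_on vec_nth {\<beta> :: nat ^ 'n. \<forall>i. \<beta> $ i \<le> m i}"
    by (auto simp: inj_on_def vec_eq_iff)
qed

lemma finite_mdeg_le: "finite {\<beta> :: nat ^ 'n::finite. mdeg \<beta> \<le> d}"
proof (rule finite_subset)
  show "{\<beta> :: nat ^ 'n. mdeg \<beta> \<le> d} \<subseteq> {\<beta>. \<forall>i. \<beta> $ i \<le> d}"
  proof safe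
    fix \<beta> :: "nat ^ 'n" and i
    assume "mdeg \<beta> \<le> d"
    moreover have "\<beta> $ i \<le> mdeg \<beta>"
      unfolding mdeg_def by (rule member_le_sum) simp_all
    ultimately show "\<beta> $ i \<le> d"
      by linarith
  qed
qed (rule finite_exponents_le)

lemma finite_exponent_decomp: "finite {(\<beta>, \<gamma>). \<beta> + \<gamma> = (\<alpha> :: nat ^ 'n::finite)}"
proof (rule finite_subset)
  show "{(\<beta>, \<gamma>). \<beta> + \<gamma> = \<alpha>}
      \<subseteq> {\<beta>. \<forall>i. \<beta> $ i \<le> \<alpha> $ i} \<times> {\<gamma>. \<forall>i. \<gamma> $ i \<le> \<alpha> $ i}"
    by auto
qed (intro finite_cartesian_product finite_exponents_le)

instantiation mfps :: (finite) comm_ring_1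
begin

lift_definition zero_mfps :: "'a mfps" is "\<lambda>_. 0" .
lift_definition one_mfps :: "'a mfps" is "\<lambda>\<alpha>. if \<alpha> = 0 then 1 else 0" .
lift_definition plus_mfps :: "'a mfps \<Rightarrow> 'a mfps \<Rightarrow> 'a mfps" is "\<lambda>f g \<alpha>. f \<alpha> + g \<alpha>" .
lift_definition minus_mfps :: "'a mfps \<Rightarrow> 'a mfps \<Rightarrow> 'a mfps" is "\<lambda>f g \<alpha>. f \<alpha> - g \<alpha>" .
lift_definition uminus_mfps :: "'a mfps \<Rightarrow> 'a mfps" is "\<lambda>f \<alpha>. - f \<alpha>" .
lift_definition times_mfps :: "'a mfps \<Rightarrow> 'a mfps \<Rightarrow> 'a mfps"
  is "\<lambda>f g \<alpha>. \<Sum>(\<beta>, \<gamma>) | \<beta> + \<gamma> = \<alpha>. f \<beta> * g \<gamma>" .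

instance
proof
  fix f g h :: "'a mfps"
  show "f * g * h = f * (g * h)"
  proof (rule mfps_eqI)
    fix \<alpha> :: "nat ^ 'a"
    let ?D = "\<lambda>\<alpha> :: nat ^ 'a. {(\<beta>, \<gamma>). \<beta> + \<gamma> = \<alpha>}"
    have fin: "finite (?D \<alpha>)" for \<alpha>
      by (rule finite_exponent_decomp)
    have "mfps_nth (f * g * h) \<alpha> =
        (\<Sum>p\<in>?D \<alpha>. \<Sum>q\<in>?D (fst p). mfps_nth f (fst q) * mfps_nth g (snd q) * mfps_nth h (snd p))"
      by (simp add: times_mfps.rep_eq case_prod_unfold sum_distrib_right)
    also have "\<dots> = (\<Sum>z\<in>Sigma (?D \<alpha>) (\<lambda>p. ?D (fst p)).
        mfps_nth f (fst (snd z)) * mfps_nth g (snd (snd z)) * mfps_nth h (snd (fst z)))"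
      by (subst sum.Sigma) (simp_all add: fin[unfolded case_prod_unfold] case_prod_unfold)
    also have "\<dots> = (\<Sum>z\<in>Sigma (?D \<alpha>) (\<lambda>p. ?D (snd p)).
        mfps_nth f (fst (fst z)) * (mfps_nth g (fst (snd z)) * mfps_nth h (snd (snd z))))"
      by (rule sum.reindex_bij_witness
            [where j = "\<lambda>((b, c), (d, e)). ((d, e + c), (e, c))"
               and i = "\<lambda>((b, c), (d, e)). ((b + d, e), (b, d))"])
         (auto simp: add.assoc mult.assoc)
    also have "\<dots> = (\<Sum>p\<in>?D \<alpha>. \<Sum>q\<in>?D (snd p).
        mfps_nth f (fst p) * (mfps_nth g (fst q) * mfps_nth h (snd q)))"
      by (subst sum.Sigma) (simp_all add: fin[unfolded case_prod_unfold] case_prod_unfold)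
    also have "\<dots> = mfps_nth (f * (g * h)) \<alpha>"
      by (simp add: times_mfps.rep_eq case_prod_unfold sum_distrib_left)
    finally show "mfps_nth (f * g * h) \<alpha> = mfps_nth (f * (g * h)) \<alpha>" .
  qed
  show "f * g = g * f"
  proof (rule mfps_eqI)
    fix \<alpha> :: "nat ^ 'a"
    show "mfps_nth (f * g) \<alpha> = mfps_nth (g * f) \<alpha>"
      unfolding times_mfps.rep_eq
      by (rule sum.reindex_bij_witness[where i = prod.swap and j = prod.swap])
         (auto simp: add.commute)
  qed
  show "1 * f = f"
  proof (rule mfps_eqI)
    fix \<alpha> :: "nat ^ 'a"
    have "mfps_nth (1 * f) \<alpha> = (\<Sum>(\<beta>, \<gamma>)\<in>{(0, \<alpha>)}. mfps_nth 1 \<beta> * mfps_nth f \<gamma>)"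
      unfolding times_mfps.rep_eq
      by (rule sum.mono_neutral_right) (auto simp: finite_exponent_decomp one_mfps.rep_eq split: if_splits)
    then show "mfps_nth (1 * f) \<alpha> = mfps_nth f \<alpha>"
      by (simp add: one_mfps.rep_eq)
  qed
  show "(f + g) * h = f * h + g * h"
    by (rule mfps_eqI)
       (simp add: times_mfps.rep_eq plus_mfps.rep_eq case_prod_unfold distrib_right sum.distrib)
  have "mfps_nth (0 :: 'a mfps) 0 \<noteq> mfps_nth 1 0"
    by (simp add: zero_mfps.rep_eq one_mfps.rep_eq)
  then show "(0 :: 'a mfps) \<noteq> 1"
    by metis
qed (rule mfps_eqI; simp add: plus_mfps.rep_eq minus_mfps.rep_eq uminus_mfps.rep_eq
       zero_mfps.rep_eq)+

end

lift_definition mfps_const :: "complex \<Rightarrow> 'n::finite mfps"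
  is "\<lambda>c \<alpha>. if \<alpha> = 0 then c else 0" .

lift_definition mfps_X :: "'n \<Rightarrow> 'n::finite mfps"
  is "\<lambda>i \<alpha>. if \<alpha> = axis i 1 then 1 else 0" .

text \<open>The formal partial derivative with respect to the variable with index \<open>i\<close>.\<close>

lift_definition mfps_deriv :: "'n \<Rightarrow> 'n::finite mfps \<Rightarrow> 'n mfps"
  is "\<lambda>i f \<alpha>. of_nat (\<alpha> $ i + 1) * f (\<alpha> + axis i 1)" .

text \<open>
  Substitution of the components of \<open>u\<close> for the variables of \<open>f\<close>. It is meaningful only if all
  components of \<open>u\<close> have zero constant term; then \<open>u\<^sup>\<beta>\<close> has no terms of degree less than
  \<open>|\<beta>|\<close>, so that the truncated sum is the full coefficient of \<open>\<Sum>\<beta>. f\<^sub>\<beta> u\<^sup>\<beta>\<close>.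
\<close>

definition mfps_compose :: "'m::finite mfps \<Rightarrow> ('n::finite mfps) ^ 'm \<Rightarrow> 'n mfps" where
  "mfps_compose f u = Abs_mfps (\<lambda>\<alpha>.
     \<Sum>\<beta> | mdeg \<beta> \<le> mdeg \<alpha>. mfps_nth f \<beta> * mfps_nth (\<Prod>i\<in>UNIV. (u $ i) ^ (\<beta> $ i)) \<alpha>)"

text \<open>Likewise \<open>f(w)\<close> for a series \<open>f\<close> in one variable and \<open>w\<close> without constant term.\<close>

definition fps_mfps_compose :: "complex fps \<Rightarrow> 'n::finite mfps \<Rightarrow> 'n mfps" where
  "fps_mfps_compose f w = Abs_mfps (\<lambda>\<alpha>. \<Sum>k\<le>mdeg \<alpha>. fps_nth f k * mfps_nth (w ^ k) \<alpha>)"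

definition mfps_convergent :: "'n::finite mfps \<Rightarrow> bool" where
  "mfps_convergent f \<longleftrightarrow> (\<exists>r>0. \<forall>x :: complex ^ 'n. (\<forall>i. cmod (x $ i) < r) \<longrightarrow>
     (\<lambda>\<alpha>. mfps_nth f \<alpha> * (\<Prod>i\<in>UNIV. (x $ i) ^ (\<alpha> $ i))) summable_on UNIV)"


section \<open>Poincare-Dulac normal forms\<close>

text \<open>
  A formal system \<open>x' = F(x)\<close> is given by the vector \<open>F\<close> of its right-hand sides; \<open>lam\<close> is the
  vector of the diagonal entries of the diagonal matrix \<open>A\<close>.
\<close>

definition diag_linear :: "complex ^ 'n \<Rightarrow> ('n::finite mfps) ^ 'n" where
  "diag_linear lam = (\<chi> k. mfps_const (lam $ k) * mfps_X k)"

definition resonant :: "complex ^ 'n \<Rightarrow> 'n \<Rightarrow> nat ^ 'n::finite \<Rightarrow> bool" where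
  "resonant lam k \<alpha> \<longleftrightarrow> mdeg \<alpha> \<ge> 2 \<and> (\<Sum>i\<in>UNIV. of_nat (\<alpha> $ i) * lam $ i) - lam $ k = 0"

definition nonresonant :: "complex ^ 'n \<Rightarrow> 'n \<Rightarrow> nat ^ 'n::finite \<Rightarrow> bool" where
  "nonresonant lam k \<alpha> \<longleftrightarrow> mdeg \<alpha> \<ge> 2 \<and> (\<Sum>i\<in>UNIV. of_nat (\<alpha> $ i) * lam $ i) - lam $ k \<noteq> 0"

text \<open>
  The change of coordinates \<open>x = \<phi>(y)\<close> turns \<open>x' = F(x)\<close> into \<open>y' = N(y)\<close>:
  differentiating \<open>x = \<phi>(y)\<close> gives \<open>F(\<phi>(y)) = D\<phi>(y) N(y)\<close>.
\<close>

definition transforms_to ::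
    "('n::finite mfps) ^ 'n \<Rightarrow> ('n mfps) ^ 'n \<Rightarrow> ('n mfps) ^ 'n \<Rightarrow> bool" where
  "transforms_to F \<phi> N \<longleftrightarrow>
     (\<forall>k. mfps_compose (F $ k) \<phi> = (\<Sum>i\<in>UNIV. mfps_deriv i (\<phi> $ k) * N $ i))"

definition normalizing_transformation ::
    "complex ^ 'n \<Rightarrow> ('n::finite mfps) ^ 'n \<Rightarrow> ('n mfps) ^ 'n \<Rightarrow> ('n mfps) ^ 'n \<Rightarrow> bool" where
  "normalizing_transformation lam F h N \<longleftrightarrow>
     (\<forall>k \<alpha>. mfps_nth (h $ k) \<alpha> \<noteq> 0 \<longrightarrow> mdeg \<alpha> \<ge> 2) \<and>
     transforms_to F (\<chi> k. mfps_X k + h $ k) N \<and>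
     (\<forall>k \<alpha>. mfps_nth ((N - diag_linear lam) $ k) \<alpha> \<noteq> 0 \<longrightarrow> resonant lam k \<alpha>)"

definition distinguished_normalizing_transformation ::
    "complex ^ 'n \<Rightarrow> ('n::finite mfps) ^ 'n \<Rightarrow> ('n mfps) ^ 'n \<Rightarrow> ('n mfps) ^ 'n \<Rightarrow> bool" where
  "distinguished_normalizing_transformation lam F h N \<longleftrightarrow>
     normalizing_transformation lam F h N \<and>
     (\<forall>k \<alpha>. mfps_nth (h $ k) \<alpha> \<noteq> 0 \<longrightarrow> nonresonant lam k \<alpha>)"

definition distinguished_normal_form ::
    "complex ^ 'n \<Rightarrow> ('n::finite mfps) ^ 'n \<Rightarrow> ('n mfps) ^ 'n \<Rightarrow> bool" where
  "distinguished_normal_form lam F N \<longleftrightarrow>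
     (\<exists>h. distinguished_normalizing_transformation lam F h N)"


section \<open>The three-dimensional system and its normal form\<close>

text \<open>In a triple \<open>(p, q, r)\<close> of \<open>S\<close> only \<open>p\<close> may be \<open>-1\<close>, so \<open>nat (p + 1)\<close> is exact.\<close>

definition resonant_system ::
    "complex \<Rightarrow> (int \<times> nat \<times> nat) set \<Rightarrow> (int \<Rightarrow> nat \<Rightarrow> nat \<Rightarrow> complex) \<Rightarrow>
     (nat \<Rightarrow> int \<Rightarrow> nat \<Rightarrow> complex) \<Rightarrow> (nat \<Rightarrow> nat \<Rightarrow> int \<Rightarrow> complex) \<Rightarrow> (3 mfps) ^ 3" where
  "resonant_system \<zeta> S a b c =
     (let x1 = mfps_X 1; x2 = mfps_X 2; x3 = mfps_X 3 in vector
       [x1 + (\<Sum>(p, q, r)\<in>S. mfps_const (a p q r) * x1 ^ nat (p + 1) * x2 ^ q * x3 ^ r),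
        mfps_const \<zeta> *
          (x2 + (\<Sum>(p, q, r)\<in>S. mfps_const (b r p q) * x1 ^ r * x2 ^ nat (p + 1) * x3 ^ q)),
        mfps_const (\<zeta>\<^sup>2) *
          (x3 + (\<Sum>(p, q, r)\<in>S. mfps_const (c q r p) * x1 ^ q * x2 ^ r * x3 ^ nat (p + 1)))])"

definition normal_form_system ::
    "complex \<Rightarrow> complex fps \<Rightarrow> complex fps \<Rightarrow> complex fps \<Rightarrow> (3 mfps) ^ 3" where
  "normal_form_system \<zeta> Y1 Y2 Y3 =
     (let y1 = mfps_X 1; y2 = mfps_X 2; y3 = mfps_X 3; w = y1 * y2 * y3 in vector
       [y1 + y1 * fps_mfps_compose Y1 w,
        mfps_const \<zeta> * y2 + y2 * fps_mfps_compose Y2 w,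
        mfps_const (\<zeta>\<^sup>2) * y3 + y3 * fps_mfps_compose Y3 w])"

end

theory Submission imports Defs begin

text \<open>
  The hypothesis \<open>Y\<^sub>1 + Y\<^sub>2 + Y\<^sub>3 = 0\<close> is Bruno's condition A for the eigenvalues \<open>1, \<zeta>, \<zeta>\<^sup>2\<close>: if
  \<open>\<Sum>z\<^sub>i = 0\<close> then \<open>\<bar>\<Sum>\<alpha>\<^sub>i z\<^sub>i\<bar> \<le> 2 \<bar>\<Sum>\<alpha>\<^sub>i \<lambda>\<^sub>i\<bar> \<Sum>\<bar>z\<^sub>i\<bar>\<close>, so in the homological equation the factor
  \<open>\<alpha>\<close> produced by differentiating \<open>h\<close> is absorbed by the divisor. The nonzero divisors are
  Eisenstein integers, hence of modulus at least \<open>1\<close>. The sums \<open>M\<^sub>n\<close> of the absolute values of all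
  terms of degree at most \<open>n\<close> of \<open>h\<close> and of the normal form, on a polydisc of radius \<open>r\<close>, therefore
  satisfy \<open>M\<^bsub>n+1\<^esub> \<le> K (r + M\<^sub>n)\<^sup>2 + C M\<^sub>n\<^sup>2 / r\<close>, which keeps \<open>M\<^sub>n \<le> \<epsilon> r\<close> for small \<open>\<epsilon>\<close> and \<open>r\<close>.
\<close>

section \<open>Coefficients of formal power series\<close>

lemma mdeg_add: "mdeg (\<alpha> + \<beta>) = mdeg \<alpha> + mdeg \<beta>"
  by (simp add: mdeg_def sum.distrib)

lemma mdeg_0 [simp]: "mdeg 0 = 0"
  by (simp add: mdeg_def)

lemma mdeg_eq_0_iff: "mdeg \<alpha> = 0 \<longleftrightarrow> \<alpha> = 0"
  by (simp add: mdeg_def vec_eq_iff)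

lemma mdeg_axis [simp]: "mdeg (axis i (Suc 0)) = Suc 0"
  by (simp add: mdeg_def axis_def)

lemma mfps_nth_add: "mfps_nth (f + g) \<alpha> = mfps_nth f \<alpha> + mfps_nth g \<alpha>"
  by (simp add: plus_mfps.rep_eq)

lemma mfps_nth_sum: "mfps_nth (\<Sum>i\<in>I. f i) \<alpha> = (\<Sum>i\<in>I. mfps_nth (f i) \<alpha>)"
  by (induction I rule: infinite_finite_induct) (auto simp: mfps_nth_add zero_mfps.rep_eq)

lemma mfps_nth_mult: "mfps_nth (f * g) \<alpha> = (\<Sum>p | fst p + snd p = \<alpha>. mfps_nth f (fst p) * mfps_nth g (snd p))"
  by (simp add: times_mfps.rep_eq case_prod_unfold)

lemma mfps_nth_mult_neq_0E:
  assumes "mfps_nth (f * g) \<alpha> \<noteq> 0"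
  obtains \<beta> \<gamma> where "\<alpha> = \<beta> + \<gamma>" "mfps_nth f \<beta> \<noteq> 0" "mfps_nth g \<gamma> \<noteq> 0"
proof -
  obtain p where "p \<in> {p. fst p + snd p = \<alpha>}" "mfps_nth f (fst p) * mfps_nth g (snd p) \<noteq> 0"
    using assms unfolding mfps_nth_mult by (rule sum.not_neutral_contains_not_neutral)
  then show ?thesis
    by (intro that[of "fst p" "snd p"]) auto
qed

lemma finite_exponent_decomp': "finite {p. fst p + snd p = (\<alpha> :: nat ^ 'n::finite)}"
  using finite_exponent_decomp[of \<alpha>] by (simp add: case_prod_unfold)

section \<open>Monomials and multiplication by them\<close>

lift_definition mfps_monom :: "nat ^ 'n::finite \<Rightarrow> 'n mfps"
  is "\<lambda>e \<alpha>. if \<alpha> = e then 1 else 0" .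

lemma mfps_nth_monom_mult:
  "mfps_nth (mfps_monom e * f) (e + \<alpha>) = mfps_nth f \<alpha>"
proof -
  have "mfps_nth (mfps_monom e * f) (e + \<alpha>) =
      (\<Sum>p\<in>{(e, \<alpha>)}. mfps_nth (mfps_monom e) (fst p) * mfps_nth f (snd p))"
    unfolding mfps_nth_mult
    by (rule sum.mono_neutral_right[OF finite_exponent_decomp'])
       (auto simp: mfps_monom.rep_eq)
  then show ?thesis
    by (simp add: mfps_monom.rep_eq)
qed

lemma mfps_nth_monom_mult_neq_0:
  assumes "mfps_nth (mfps_monom e * f) \<alpha> \<noteq> 0"
  obtains \<beta> where "\<alpha> = e + \<beta>" "mfps_nth f \<beta> \<noteq> 0"
  using assms
  by (elim mfps_nth_mult_neq_0E) (auto simp: mfps_monom.rep_eq intro: that split: if_splits)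

lemma mfps_monom_add: "mfps_monom (d + e) = mfps_monom d * mfps_monom e"
proof (rule mfps_eqI)
  fix \<alpha>
  show "mfps_nth (mfps_monom (d + e)) \<alpha> = mfps_nth (mfps_monom d * mfps_monom e) \<alpha>"
  proof (cases "\<exists>\<beta>. \<alpha> = d + \<beta>")
    case True
    then show ?thesis
      by (auto simp: mfps_nth_monom_mult) (auto simp: mfps_monom.rep_eq)
  next
    case False
    then show ?thesis
      using mfps_nth_monom_mult_neq_0[of d "mfps_monom e" \<alpha>]
      by (auto simp: mfps_monom.rep_eq)
  qed
qed

lemma mfps_monom_0: "mfps_monom 0 = 1"
  by (rule mfps_eqI) (simp add: mfps_monom.rep_eq one_mfps.rep_eq)

lemma mfps_X_eq_monom: "mfps_X i = mfps_monom (axis i 1)"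
  by (rule mfps_eqI) (simp add: mfps_monom.rep_eq mfps_X.rep_eq)

lemma mfps_monom_power: "mfps_monom e ^ k = mfps_monom (\<chi> i. k * e $ i)"
proof (induction k)
  case 0
  then show ?case
    by (simp add: mfps_monom_0[symmetric] zero_vec_def)
next
  case (Suc k)
  have "(\<chi> i. Suc k * e $ i) = e + (\<chi> i. k * e $ i)"
    by (simp add: vec_eq_iff)
  then show ?case
    by (simp add: Suc mfps_monom_add del: mult_Suc)
qed

lemma mfps_nth_const_mult:
  fixes f :: "'n::finite mfps"
  shows "mfps_nth (mfps_const c * f) \<alpha> = c * mfps_nth f \<alpha>"
proof -
  have "mfps_nth (mfps_const c * f) \<alpha> =
      (\<Sum>p\<in>{(0, \<alpha>)}. mfps_nth (mfps_const c :: 'n mfps) (fst p) * mfps_nth f (snd p))"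
    unfolding mfps_nth_mult
    by (rule sum.mono_neutral_right[OF finite_exponent_decomp'])
       (auto simp: mfps_const.rep_eq)
  then show ?thesis
    by (simp add: mfps_const.rep_eq)
qed

text \<open>The Euler operator \<open>x_i d/dx_i\<close> is diagonal on monomials. Every component
  of the normal form has its own variable as a factor, so derivatives of h enter the transformation
  equation only through these operators.\<close>

lemma mfps_nth_deriv_mult_X:
  "mfps_nth (mfps_deriv i f * mfps_X i) \<alpha> = of_nat (\<alpha> $ i) * mfps_nth f \<alpha>"
proof (cases "\<alpha> $ i = 0")
  case True
  have "\<alpha> \<noteq> axis i 1 + \<beta>" for \<beta>
    using True by (auto simp: vec_eq_iff axis_def)
  then show ?thesis
    using mfps_nth_monom_mult_neq_0[of "axis i 1" "mfps_deriv i f" \<alpha>] True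
    by (auto simp: mult.commute mfps_X_eq_monom)
next
  case False
  \<comment> \<open>Since \<alpha> has a positive i-th entry in this case, the truncated subtraction
    on naturals is exact.\<close>
  define \<beta> where "\<beta> = (\<chi> j. \<alpha> $ j - axis i 1 $ j)"
  have \<alpha>: "\<alpha> = axis i 1 + \<beta>"
    using False by (auto simp: \<beta>_def vec_eq_iff axis_def)
  have "\<alpha> $ i = Suc (\<beta> $ i)"
    using False by (simp add: \<beta>_def)
  moreover have "mfps_nth (mfps_deriv i f * mfps_X i) \<alpha> = of_nat (Suc (\<beta> $ i)) * mfps_nth f \<alpha>"
    unfolding \<alpha> mult.commute[of "mfps_deriv i f"] mfps_X_eq_monom mfps_nth_monom_mult
    by (simp add: mfps_deriv.rep_eq add.commute)
  ultimately show ?thesis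
    by simp
qed

lemma mfps_deriv_add: "mfps_deriv i (f + g) = mfps_deriv i f + mfps_deriv i g"
  by (rule mfps_eqI) (simp add: mfps_deriv.rep_eq mfps_nth_add algebra_simps)

section \<open>Composition of power series\<close>

lemma mfps_nth_compose:
  "mfps_nth (mfps_compose f u) \<alpha> =
     (\<Sum>\<beta> | mdeg \<beta> \<le> mdeg \<alpha>. mfps_nth f \<beta> * mfps_nth (\<Prod>i\<in>UNIV. (u $ i) ^ (\<beta> $ i)) \<alpha>)"
  by (simp add: mfps_compose_def Abs_mfps_inverse)

lemma mfps_compose_add: "mfps_compose (f + g) u = mfps_compose f u + mfps_compose g u"
  by (rule mfps_eqI) (simp add: mfps_nth_compose mfps_nth_add distrib_right sum.distrib)

text \<open>At \<alpha> = 0 the truncated sum that defines composition omits the linear exponent, so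
  its value there is 0. This agrees with the right-hand side because \<open>u $ k\<close> has no
  constant term.\<close>

lemma mfps_compose_const_mult_X:
  assumes "mfps_nth (u $ k) 0 = 0"
  shows "mfps_compose (mfps_const c * mfps_X k) u = mfps_const c * u $ k"
proof (rule mfps_eqI)
  fix \<alpha>
  have "mfps_nth (mfps_compose (mfps_const c * mfps_X k) u) \<alpha> =
     (\<Sum>\<beta> | mdeg \<beta> \<le> mdeg \<alpha>. if \<beta> = axis k 1 then
        c * mfps_nth (\<Prod>i\<in>UNIV. (u $ i) ^ (\<beta> $ i)) \<alpha> else 0)"
    unfolding mfps_nth_compose
    by (intro sum.cong) (auto simp: mfps_nth_const_mult mfps_X.rep_eq)
  also have "\<dots> = (if mdeg \<alpha> \<ge> 1 then
        c * mfps_nth (\<Prod>i\<in>UNIV. (u $ i) ^ (axis k 1 $ i)) \<alpha> else 0)"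
    by (simp add: sum.delta finite_mdeg_le)
  also have "(\<Prod>i\<in>UNIV. (u $ i) ^ (axis k 1 $ i)) = (\<Prod>i\<in>UNIV. if i = k then u $ i else 1)"
    by (intro prod.cong) (auto simp: axis_def)
  also have "\<dots> = u $ k"
    by simp
  finally show "mfps_nth (mfps_compose (mfps_const c * mfps_X k) u) \<alpha> = mfps_nth (mfps_const c * u $ k) \<alpha>"
    using assms by (cases "\<alpha> = 0") (auto simp: mfps_nth_const_mult mdeg_eq_0_iff not_less_eq_eq)
qed

section \<open>Truncated weighted norms\<close>

text \<open>A weighted l1-norm on the polydisc of radius r, cut off at degree n. The cut keeps it
  finite for a merely formal series; a bound uniform in n amounts to absolute convergence.\<close>

definition trunc_norm :: "real \<Rightarrow> nat \<Rightarrow> 'n::finite mfps \<Rightarrow> real" where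
  "trunc_norm r n f = (\<Sum>\<alpha> | mdeg \<alpha> \<le> n. cmod (mfps_nth f \<alpha>) * r ^ mdeg \<alpha>)"

text \<open>Passing to absolute values turns the majorizing convolution into a product of series, to
  which the product estimate for truncated norms applies.\<close>

lift_definition mfps_abs :: "'n::finite mfps \<Rightarrow> 'n mfps"
  is "\<lambda>f \<alpha>. complex_of_real (cmod (f \<alpha>))" .

lemma trunc_norm_abs [simp]: "trunc_norm r n (mfps_abs f) = trunc_norm r n f"
  by (simp add: trunc_norm_def mfps_abs.rep_eq)

lemma trunc_norm_nonneg: "0 \<le> r \<Longrightarrow> 0 \<le> trunc_norm r n f"
  by (simp add: trunc_norm_def sum_nonneg)

lemma trunc_norm_mono: "0 \<le> r \<Longrightarrow> m \<le> n \<Longrightarrow> trunc_norm r m f \<le> trunc_norm r n f"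
  unfolding trunc_norm_def by (rule sum_mono2) (auto simp: finite_mdeg_le)

lemma trunc_norm_triangle: "0 \<le> r \<Longrightarrow> trunc_norm r n (f + g) \<le> trunc_norm r n f + trunc_norm r n g"
  unfolding trunc_norm_def sum.distrib[symmetric] distrib_right[symmetric] mfps_nth_add
  by (intro sum_mono mult_right_mono norm_triangle_ineq) auto

lemma trunc_norm_const_mult: "trunc_norm r n (mfps_const c * f) = cmod c * trunc_norm r n f"
  by (simp add: trunc_norm_def mfps_nth_const_mult norm_mult sum_distrib_left mult.assoc)

lemma trunc_norm_1: "trunc_norm r n (1 :: 'n::finite mfps) = 1"
proof -
  have "trunc_norm r n (1 :: 'n mfps) = (\<Sum>\<alpha>\<in>{0}. cmod (mfps_nth (1 :: 'n mfps) \<alpha>) * r ^ mdeg \<alpha>)"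
    unfolding trunc_norm_def
    by (rule sum.mono_neutral_right) (auto simp: one_mfps.rep_eq finite_mdeg_le)
  then show ?thesis
    by (simp add: one_mfps.rep_eq)
qed

text \<open>Translation by e is injective on exponents and raises each degree by
  \<open>mdeg e\<close>. It serves to recover a bound for W from one for \<open>x_i W_i\<close>, at
  the price of a factor 1/r and with the gain of one degree.\<close>

lemma trunc_norm_monom_mult:
  assumes "0 \<le> r"
  shows "r ^ mdeg e * trunc_norm r n f \<le> trunc_norm r (mdeg e + n) (mfps_monom e * f)"
proof -
  have "r ^ mdeg e * trunc_norm r n f =
      (\<Sum>\<alpha> | mdeg \<alpha> \<le> n. cmod (mfps_nth (mfps_monom e * f) (e + \<alpha>)) * r ^ mdeg (e + \<alpha>))"
    unfolding trunc_norm_def sum_distrib_left mfps_nth_monom_mult mdeg_add power_add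
    by (intro sum.cong) (auto simp: ac_simps)
  also have "\<dots> = (\<Sum>\<alpha>\<in>(+) e ` {\<alpha>. mdeg \<alpha> \<le> n}. cmod (mfps_nth (mfps_monom e * f) \<alpha>) * r ^ mdeg \<alpha>)"
    by (subst sum.reindex) (auto simp: inj_on_def)
  also have "\<dots> \<le> trunc_norm r (mdeg e + n) (mfps_monom e * f)"
    unfolding trunc_norm_def using assms
    by (intro sum_mono2) (auto simp: finite_mdeg_le mdeg_add)
  finally show ?thesis .
qed

lemma trunc_norm_X_le:
  assumes "0 \<le> r" shows "trunc_norm r n (mfps_X i) \<le> r"
proof -
  have "trunc_norm r n (mfps_X i) = (\<Sum>\<alpha> | mdeg \<alpha> \<le> n. if \<alpha> = axis i 1 then r else 0)"
    unfolding trunc_norm_def by (intro sum.cong) (auto simp: mfps_X.rep_eq)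
  then show ?thesis
    using assms by (simp add: sum.delta' finite_mdeg_le)
qed

section \<open>Lower bounds for the order, and their effect on norms of products\<close>

definition order_ge :: "nat \<Rightarrow> 'n::finite mfps \<Rightarrow> bool" where
  "order_ge d f \<longleftrightarrow> (\<forall>\<alpha>. mfps_nth f \<alpha> \<noteq> 0 \<longrightarrow> d \<le> mdeg \<alpha>)"

lemma order_ge_0 [simp]: "order_ge 0 f"
  by (simp add: order_ge_def)

lemma order_ge_abs [simp]: "order_ge d (mfps_abs f) = order_ge d f"
  by (simp add: order_ge_def mfps_abs.rep_eq)

text \<open>An order of one factor lowers the degree up to which the other factor matters; this is
  what makes the majorant recursion well-founded.\<close>

lemma trunc_norm_mult:
  assumes r: "0 \<le> r" and f: "order_ge a f" and g: "order_ge b g"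
  shows "trunc_norm r n (f * g) \<le> trunc_norm r (n - b) f * trunc_norm r (n - a) g"
proof -
  define t where "t p = (cmod (mfps_nth f (fst p)) * r ^ mdeg (fst p)) *
      (cmod (mfps_nth g (snd p)) * r ^ mdeg (snd p))" for p
  have t: "t p \<ge> 0" for p
    using r by (simp add: t_def)
  let ?D = "\<lambda>\<alpha>. {p. fst p + snd p = \<alpha>}"
  let ?A = "{\<alpha>. mdeg \<alpha> \<le> n}"
  have fin: "finite (\<Union> (?D ` ?A))"
    by (intro finite_UN_I finite_mdeg_le finite_exponent_decomp')
  have "trunc_norm r n (f * g) \<le> (\<Sum>\<alpha>\<in>?A. \<Sum>p\<in>?D \<alpha>. t p)"
    unfolding trunc_norm_def
  proof (rule sum_mono)
    fix \<alpha>
    have "cmod (mfps_nth (f * g) \<alpha>) * r ^ mdeg \<alpha>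
        \<le> (\<Sum>p\<in>?D \<alpha>. cmod (mfps_nth f (fst p) * mfps_nth g (snd p))) * r ^ mdeg \<alpha>"
      unfolding mfps_nth_mult using r by (intro mult_right_mono norm_sum) auto
    also have "\<dots> = (\<Sum>p\<in>?D \<alpha>. t p)"
      unfolding sum_distrib_right
      by (intro sum.cong) (auto simp: t_def norm_mult mdeg_add power_add)
    finally show "cmod (mfps_nth (f * g) \<alpha>) * r ^ mdeg \<alpha> \<le> (\<Sum>p\<in>?D \<alpha>. t p)" .
  qed
  also have "\<dots> = sum t (\<Union> (?D ` ?A))"
    by (rule sum.UNION_disjoint[symmetric]) (auto simp: finite_mdeg_le finite_exponent_decomp')
  \<comment> \<open>Vanishing terms are discarded first: on the remaining pairs the orders force the
    degrees to be at least a and b, and the total bound n then limits the other factor to degree n -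
    b or n - a.\<close>
  also have "\<dots> = sum t {p \<in> \<Union> (?D ` ?A). t p \<noteq> 0}"
    by (rule sum.mono_neutral_right) (use fin in auto)
  also have "\<dots> \<le> sum t ({\<beta>. mdeg \<beta> \<le> n - b} \<times> {\<gamma>. mdeg \<gamma> \<le> n - a})"
  proof (rule sum_mono2)
    show "{p \<in> \<Union> (?D ` ?A). t p \<noteq> 0} \<subseteq> {\<beta>. mdeg \<beta> \<le> n - b} \<times> {\<gamma>. mdeg \<gamma> \<le> n - a}"
    proof safe
      fix \<beta> \<gamma>
      assume *: "mdeg (fst (\<beta>, \<gamma>) + snd (\<beta>, \<gamma>)) \<le> n" "t (\<beta>, \<gamma>) \<noteq> 0"
      then have "a \<le> mdeg \<beta>" "b \<le> mdeg \<gamma>"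
        using f g by (auto simp: order_ge_def t_def)
      with * show "mdeg \<beta> \<le> n - b" "mdeg \<gamma> \<le> n - a"
        by (auto simp: mdeg_add)
    qed
  qed (auto simp: finite_mdeg_le t)
  also have "\<dots> = trunc_norm r (n - b) f * trunc_norm r (n - a) g"
    by (simp add: trunc_norm_def t_def sum_product sum.cartesian_product case_prod_unfold)
  finally show ?thesis .
qed

lemma trunc_norm_power_prod:
  assumes r: "0 \<le> r" and u: "\<And>i. trunc_norm r n (u $ i) \<le> R"
  shows "trunc_norm r n (\<Prod>i\<in>UNIV. (u $ i) ^ (\<beta> $ i)) \<le> R ^ mdeg \<beta>"
proof -
  have "0 \<le> R"
    using order.trans[OF trunc_norm_nonneg[OF r] u] .
  have mult: "trunc_norm r n (f * g) \<le> A * B"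
    if "trunc_norm r n f \<le> A" "trunc_norm r n g \<le> B" for f g :: "'b mfps" and A B
    using trunc_norm_mult[OF r order_ge_0[of f] order_ge_0[of g], of n]
      mult_mono[OF that order.trans[OF trunc_norm_nonneg[OF r] that(1)] trunc_norm_nonneg[OF r]]
    by simp
  have pow: "trunc_norm r n ((u $ i) ^ m) \<le> R ^ m" for i m
    by (induction m) (auto simp: trunc_norm_1 intro: mult u)
  have "trunc_norm r n (\<Prod>i\<in>I. (u $ i) ^ (\<beta> $ i)) \<le> (\<Prod>i\<in>I. R ^ (\<beta> $ i))" for I
    by (induction I rule: infinite_finite_induct) (auto simp: trunc_norm_1 intro: mult pow)
  then show ?thesis
    by (simp add: mdeg_def power_sum)
qed

lemma order_ge_mult:
  assumes "order_ge a f" "order_ge b g"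
  shows "order_ge (a + b) (f * g)"
  unfolding order_ge_def
proof safe
  fix \<alpha> assume "mfps_nth (f * g) \<alpha> \<noteq> 0"
  with assms show "a + b \<le> mdeg \<alpha>"
    by (elim mfps_nth_mult_neq_0E) (auto simp: order_ge_def mdeg_add intro: add_mono)
qed

lemma order_ge_power_prod:
  assumes "\<And>i. order_ge 1 (u $ i)"
  shows "order_ge (mdeg \<beta>) (\<Prod>i\<in>UNIV. (u $ i) ^ (\<beta> $ i))"
proof -
  have pow: "order_ge m ((u $ i) ^ m)" for i m
    by (induction m) (auto dest: order_ge_mult[OF assms])
  have "order_ge (\<Sum>i\<in>I. \<beta> $ i) (\<Prod>i\<in>I. (u $ i) ^ (\<beta> $ i))" for I
    by (induction I rule: infinite_finite_induct) (auto intro: order_ge_mult pow)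
  then show ?thesis
    by (simp add: mdeg_def)
qed

text \<open>One factor \<open>u $ k\<close> is split off. As the total exponent is at least 2, the
  remaining product still has order at least 1, so degree n + 1 of the whole product involves both
  parts only up to degree n. This gain of one degree drives the recursion.\<close>

lemma trunc_norm_power_prod_Suc:
  assumes r: "0 \<le> r" and u: "\<And>i. trunc_norm r n (u $ i) \<le> R"
    and ord: "\<And>i. order_ge 1 (u $ i)" and \<beta>: "mdeg \<beta> \<ge> 2"
  shows "trunc_norm r (Suc n) (\<Prod>i\<in>UNIV. (u $ i) ^ (\<beta> $ i)) \<le> R ^ mdeg \<beta>"
proof -
  have "0 \<le> R"
    using order.trans[OF trunc_norm_nonneg[OF r] u] .
  obtain k where k: "\<beta> $ k > 0"
    using \<beta> mdeg_eq_0_iff[of \<beta>] by (auto simp: vec_eq_iff)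
  define \<gamma> where "\<gamma> = (\<chi> j. \<beta> $ j - axis k 1 $ j)"
  have \<beta>_eq: "\<beta> = axis k 1 + \<gamma>"
    using k by (auto simp: \<gamma>_def vec_eq_iff axis_def)
  then have deg: "mdeg \<beta> = Suc (mdeg \<gamma>)"
    by (simp add: mdeg_add)
  have "(\<Prod>i\<in>UNIV. (u $ i) ^ (axis k 1 $ i)) = (\<Prod>i\<in>UNIV. if i = k then u $ i else 1)"
    by (intro prod.cong) (auto simp: axis_def)
  then have "(\<Prod>i\<in>UNIV. (u $ i) ^ (\<beta> $ i)) = u $ k * (\<Prod>i\<in>UNIV. (u $ i) ^ (\<gamma> $ i))"
    by (simp add: \<beta>_eq power_add prod.distrib)
  moreover have "trunc_norm r (Suc n) (u $ k * (\<Prod>i\<in>UNIV. (u $ i) ^ (\<gamma> $ i)))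
      \<le> trunc_norm r n (u $ k) * trunc_norm r n (\<Prod>i\<in>UNIV. (u $ i) ^ (\<gamma> $ i))"
  proof -
    have "order_ge 1 (\<Prod>i\<in>UNIV. (u $ i) ^ (\<gamma> $ i))"
      using order_ge_power_prod[OF ord, of \<gamma>] \<beta> by (auto simp: order_ge_def deg)
    from trunc_norm_mult[OF r ord this, of "Suc n"] show ?thesis by simp
  qed
  moreover have "\<dots> \<le> R * R ^ mdeg \<gamma>"
    by (intro mult_mono u trunc_norm_power_prod r trunc_norm_nonneg \<open>0 \<le> R\<close>)
  ultimately show ?thesis
    by (simp add: deg)
qed

text \<open>G is a polynomial, so the estimate for single monomials in u can be summed over the
  finite set B. All its monomials have degree at least 2, and R \<le> 1 reduces their powers of R to
  the square.\<close>

lemma trunc_norm_compose_Suc: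
  assumes r: "0 \<le> r" and u: "\<And>i. trunc_norm r n (u $ i) \<le> R" and R: "R \<le> 1"
    and ord: "\<And>i. order_ge 1 (u $ i)" and G: "order_ge 2 G"
    and B: "finite B" "\<And>\<beta>. mfps_nth G \<beta> \<noteq> 0 \<Longrightarrow> \<beta> \<in> B"
  shows "trunc_norm r (Suc n) (mfps_compose G u) \<le> (\<Sum>\<beta>\<in>B. cmod (mfps_nth G \<beta>)) * R\<^sup>2"
proof -
  have "0 \<le> R"
    using order.trans[OF trunc_norm_nonneg[OF r] u] .
  let ?P = "\<lambda>\<beta>. \<Prod>i\<in>UNIV. (u $ i) ^ (\<beta> $ i)"
  have "trunc_norm r (Suc n) (mfps_compose G u) \<le>
      (\<Sum>\<alpha> | mdeg \<alpha> \<le> Suc n. (\<Sum>\<beta>\<in>B. cmod (mfps_nth G \<beta>) * cmod (mfps_nth (?P \<beta>) \<alpha>)) * r ^ mdeg \<alpha>)"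
    unfolding trunc_norm_def
  proof (intro sum_mono mult_right_mono)
    fix \<alpha>
    have "cmod (mfps_nth (mfps_compose G u) \<alpha>) \<le>
        (\<Sum>\<beta> | mdeg \<beta> \<le> mdeg \<alpha>. cmod (mfps_nth G \<beta>) * cmod (mfps_nth (?P \<beta>) \<alpha>))"
      unfolding mfps_nth_compose norm_mult[symmetric] by (rule norm_sum)
    \<comment> \<open>Composition only looks at exponents of degree at most that of \<alpha>; the
      passage to all of B adds nonnegative terms and makes the range independent of
      \<alpha>.\<close>
    also have "\<dots> = (\<Sum>\<beta>\<in>{\<beta>. mdeg \<beta> \<le> mdeg \<alpha>} \<inter> B. cmod (mfps_nth G \<beta>) * cmod (mfps_nth (?P \<beta>) \<alpha>))"
      by (rule sum.mono_neutral_right) (auto simp: finite_mdeg_le dest: B(2))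
    also have "\<dots> \<le> (\<Sum>\<beta>\<in>B. cmod (mfps_nth G \<beta>) * cmod (mfps_nth (?P \<beta>) \<alpha>))"
      by (rule sum_mono2) (auto simp: B(1))
    finally show "cmod (mfps_nth (mfps_compose G u) \<alpha>)
        \<le> (\<Sum>\<beta>\<in>B. cmod (mfps_nth G \<beta>) * cmod (mfps_nth (?P \<beta>) \<alpha>))" .
  qed (use r in auto)
  also have "\<dots> = (\<Sum>\<beta>\<in>B. cmod (mfps_nth G \<beta>) * trunc_norm r (Suc n) (?P \<beta>))"
    unfolding trunc_norm_def sum_distrib_left sum_distrib_right
    by (subst sum.swap) (simp add: mult.assoc)
  also have "\<dots> \<le> (\<Sum>\<beta>\<in>B. cmod (mfps_nth G \<beta>) * R\<^sup>2)"
  proof (rule sum_mono)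
    fix \<beta>
    show "cmod (mfps_nth G \<beta>) * trunc_norm r (Suc n) (?P \<beta>) \<le> cmod (mfps_nth G \<beta>) * R\<^sup>2"
    proof (cases "mfps_nth G \<beta> = 0")
      case False
      then have 2: "2 \<le> mdeg \<beta>"
        using G by (simp add: order_ge_def)
      have "trunc_norm r (Suc n) (?P \<beta>) \<le> R ^ mdeg \<beta>"
        by (rule trunc_norm_power_prod_Suc[OF r u ord 2])
      also have "\<dots> \<le> R\<^sup>2"
        by (rule power_decreasing) (use 2 R \<open>0 \<le> R\<close> in auto)
      finally show ?thesis
        by (rule mult_left_mono) simp
    qed simp
  qed
  finally show ?thesis
    by (simp add: sum_distrib_right)
qed

text \<open>Any finite set of exponents has bounded degree, so its absolute partial sum on the
  polydisc is dominated by some truncated norm, hence by B.\<close>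

lemma mfps_convergentI:
  fixes f :: "'n::finite mfps"
  assumes r: "0 < r" and B: "\<And>n. trunc_norm r n f \<le> B"
  shows "mfps_convergent f"
  unfolding mfps_convergent_def
proof (intro exI[of _ r] conjI allI impI)
  fix x :: "complex ^ 'n"
  assume x: "\<forall>i. cmod (x $ i) < r"
  let ?t = "\<lambda>\<alpha>. mfps_nth f \<alpha> * (\<Prod>i\<in>UNIV. (x $ i) ^ (\<alpha> $ i))"
  have bound: "cmod (?t \<alpha>) \<le> cmod (mfps_nth f \<alpha>) * r ^ mdeg \<alpha>" for \<alpha>
  proof -
    have "cmod (\<Prod>i\<in>UNIV. (x $ i) ^ (\<alpha> $ i)) \<le> (\<Prod>i\<in>UNIV. r ^ (\<alpha> $ i))"
      unfolding prod_norm[symmetric]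
      by (rule prod_mono) (use x in \<open>auto simp: norm_power intro!: power_mono intro: less_imp_le\<close>)
    then show ?thesis
      unfolding norm_mult by (intro mult_left_mono) (auto simp: mdeg_def power_sum)
  qed
  show "?t summable_on UNIV"
  proof (rule abs_summable_summable, rule nonneg_bdd_above_summable_on)
    show "bdd_above (sum (\<lambda>\<alpha>. norm (?t \<alpha>)) ` {F. F \<subseteq> UNIV \<and> finite F})"
    proof (rule bdd_aboveI2)
      fix F :: "(nat ^ 'n) set"
      assume "F \<in> {F. F \<subseteq> UNIV \<and> finite F}"
      then have F: "finite F" by simp
      have "(\<Sum>\<alpha>\<in>F. norm (?t \<alpha>)) \<le> (\<Sum>\<alpha>\<in>F. cmod (mfps_nth f \<alpha>) * r ^ mdeg \<alpha>)"
        by (intro sum_mono bound)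
      \<comment> \<open>The sum of all degrees in F is a convenient common bound for the degree of
        each element.\<close>
      also have "\<dots> \<le> trunc_norm r (\<Sum>\<alpha>\<in>F. mdeg \<alpha>) f"
        unfolding trunc_norm_def
        by (rule sum_mono2) (use F r in \<open>auto simp: finite_mdeg_le intro: member_le_sum\<close>)
      also have "\<dots> \<le> B"
        by (rule B)
      finally show "(\<Sum>\<alpha>\<in>F. norm (?t \<alpha>)) \<le> B" .
    qed
  qed auto
qed (use r in auto)

section \<open>Divisors in the ring of Eisenstein integers\<close>

lemma primitive_cube_root:
  fixes \<zeta> :: complex
  assumes "\<zeta> ^ 3 = 1" "\<zeta> \<noteq> 1"
  shows "1 + \<zeta> + \<zeta>\<^sup>2 = 0"
proof -
  have "(\<zeta> - 1) * (1 + \<zeta> + \<zeta>\<^sup>2) = \<zeta> ^ 3 - 1"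
    by (simp add: algebra_simps power2_eq_square power3_eq_cube)
  with assms show ?thesis by simp
qed

text \<open>The equation for \<zeta> forces real part -1/2 and squared imaginary part 3/4, which
  yields the norm form of the Eisenstein integers.\<close>

lemma cmod_eisenstein:
  fixes m n :: int and \<zeta> :: complex
  assumes \<zeta>: "1 + \<zeta> + \<zeta>\<^sup>2 = 0"
  shows "(cmod (of_int m + of_int n * \<zeta>))\<^sup>2 = of_int (m\<^sup>2 - m * n + n\<^sup>2)"
proof -
  have im: "Im \<zeta> * (1 + 2 * Re \<zeta>) = 0" and re: "1 + Re \<zeta> + (Re \<zeta>)\<^sup>2 - (Im \<zeta>)\<^sup>2 = 0"
    using arg_cong[OF \<zeta>, of Im] arg_cong[OF \<zeta>, of Re]
    by (auto simp: power2_eq_square algebra_simps)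
  have "Im \<zeta> \<noteq> 0"
  proof
    assume "Im \<zeta> = 0"
    \<comment> \<open>Completing the square shows that \<zeta> cannot be real.\<close>
    with re have "(Re \<zeta> + 1/2)\<^sup>2 + 3/4 = 0"
      by (simp add: power2_eq_square algebra_simps)
    then show False
      using zero_le_power2[of "Re \<zeta> + 1/2"] by linarith
  qed
  with im have "1 + 2 * Re \<zeta> = 0"
    by simp
  then have x: "Re \<zeta> = -1/2" by linarith
  with re have y: "(Im \<zeta>)\<^sup>2 = 3/4"
    by (simp add: power2_eq_square)
  show ?thesis
    unfolding cmod_power2
    by (simp add: x y power_mult_distrib) (simp add: power2_eq_square field_simps)
qed

text \<open>The norm form takes integer values, and a positive integer is at least 1: there are no
  small divisors.\<close>

lemma cmod_eisenstein_ge_1: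
  fixes m n :: int
  assumes "1 + \<zeta> + \<zeta>\<^sup>2 = 0" and "of_int m + of_int n * \<zeta> \<noteq> (0 :: complex)"
  shows "1 \<le> cmod (of_int m + of_int n * \<zeta>)"
proof -
  let ?z = "of_int m + of_int n * \<zeta> :: complex"
  have eq: "(cmod ?z)\<^sup>2 = of_int (m\<^sup>2 - m * n + n\<^sup>2)"
    by (rule cmod_eisenstein[OF assms(1)])
  moreover have "(cmod ?z)\<^sup>2 > 0"
    using assms(2) by simp
  ultimately have "m\<^sup>2 - m * n + n\<^sup>2 \<ge> 1"
    by (metis of_int_0_less_iff int_one_le_iff_zero_less)
  then have "(1::real) \<le> of_int (m\<^sup>2 - m * n + n\<^sup>2)"
    by linarith
  then have "1\<^sup>2 \<le> (cmod ?z)\<^sup>2"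
    by (simp add: eq)
  then show ?thesis
    by (rule power2_le_imp_le) simp
qed

lemma abs_le_cmod_eisenstein:
  fixes m n :: int
  assumes "1 + \<zeta> + \<zeta>\<^sup>2 = 0"
  shows "real_of_int \<bar>m\<bar> \<le> 2 * cmod (of_int m + of_int n * \<zeta>)"
    and "real_of_int \<bar>n\<bar> \<le> 2 * cmod (of_int m + of_int n * \<zeta>)"
proof -
  let ?z = "of_int m + of_int n * \<zeta> :: complex"
  have eq: "(2 * cmod ?z)\<^sup>2 = 4 * ((of_int m)\<^sup>2 - of_int m * of_int n + (of_int n)\<^sup>2)"
    by (simp add: power_mult_distrib cmod_eisenstein[OF assms(1)])
  \<comment> \<open>Four times the norm form is a square plus three times the square of one
    coordinate. The threefold term is split as 2 + 1 so that the required square stands alone beside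
    nonnegative terms.\<close>
  have "(2 * cmod ?z)\<^sup>2 = (of_int m - 2 * of_int n)\<^sup>2 + 2 * (of_int m)\<^sup>2 + (of_int m)\<^sup>2"
    unfolding eq by (simp add: power2_eq_square algebra_simps)
  then have "(of_int m)\<^sup>2 \<le> (2 * cmod ?z)\<^sup>2"
    by simp
  then show "real_of_int \<bar>m\<bar> \<le> 2 * cmod ?z"
    using power2_le_imp_le[of "real_of_int \<bar>m\<bar>" "2 * cmod ?z"] by simp
  have "(2 * cmod ?z)\<^sup>2 = (2 * of_int m - of_int n)\<^sup>2 + 2 * (of_int n)\<^sup>2 + (of_int n)\<^sup>2"
    unfolding eq by (simp add: power2_eq_square algebra_simps)
  then have "(of_int n)\<^sup>2 \<le> (2 * cmod ?z)\<^sup>2"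
    by simp
  then show "real_of_int \<bar>n\<bar> \<le> 2 * cmod ?z"
    using power2_le_imp_le[of "real_of_int \<bar>n\<bar>" "2 * cmod ?z"] by simp
qed

text \<open>Both triples sum to zero, so the third entry can be eliminated on either side. The same
  differences l - n and m - n remain, and each is controlled by the modulus of the Eisenstein
  integer they form.\<close>

lemma cmod_combination_le_eisenstein:
  fixes l m n :: int
  assumes \<zeta>: "1 + \<zeta> + \<zeta>\<^sup>2 = 0" and z: "z1 + z2 + z3 = (0 :: complex)"
  shows "cmod (of_int l * z1 + of_int m * z2 + of_int n * z3)
    \<le> 2 * cmod (of_int l + of_int m * \<zeta> + of_int n * \<zeta>\<^sup>2) * (cmod z1 + cmod z2 + cmod z3)"
proof -
  have \<zeta>2: "\<zeta>\<^sup>2 = - 1 - \<zeta>" and z3: "z3 = - z1 - z2"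
    using \<zeta> z by algebra+
  have eq: "of_int l + of_int m * \<zeta> + of_int n * \<zeta>\<^sup>2 = of_int (l - n) + of_int (m - n) * \<zeta>"
    by (simp add: \<zeta>2 algebra_simps)
  let ?d = "2 * cmod (of_int (l - n) + of_int (m - n) * \<zeta>)"
  have "of_int l * z1 + of_int m * z2 + of_int n * z3 = of_int (l - n) * z1 + of_int (m - n) * z2"
    by (simp add: z3 algebra_simps)
  also have "cmod \<dots> \<le> of_int \<bar>l - n\<bar> * cmod z1 + of_int \<bar>m - n\<bar> * cmod z2"
    by (rule order.trans[OF norm_triangle_ineq])
       (simp only: norm_mult norm_of_int of_int_abs order.refl)
  also have "\<dots> \<le> ?d * cmod z1 + ?d * cmod z2"
    by (intro add_mono mult_right_mono abs_le_cmod_eisenstein \<zeta>) auto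
  also have "\<dots> \<le> ?d * (cmod z1 + cmod z2 + cmod z3)"
    by (simp add: distrib_left)
  finally show ?thesis
    unfolding eq .
qed

section \<open>Convergence under Bruno's condition A\<close>

lemma cmod_nth_abs_mult:
  "cmod (mfps_nth (mfps_abs f * mfps_abs g) \<alpha>) =
     (\<Sum>p | fst p + snd p = \<alpha>. cmod (mfps_nth f (fst p)) * cmod (mfps_nth g (snd p)))"
proof -
  have "mfps_nth (mfps_abs f * mfps_abs g) \<alpha> = of_real
     (\<Sum>p | fst p + snd p = \<alpha>. cmod (mfps_nth f (fst p)) * cmod (mfps_nth g (snd p)))"
    by (simp add: mfps_nth_mult mfps_abs.rep_eq)
  then show ?thesis
    by (simp only: norm_of_real abs_of_nonneg sum_nonneg mult_nonneg_nonneg norm_ge_zero)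
qed

text \<open>The setting keeps condition A in the form the majorant argument uses:
  \<open>divisor_dominates\<close> compares the factor by which the vector field with components
  \<open>x_i W_i\<close> acts on a monomial of h with the divisor of that monomial. The particular
  eigenvalues matter only through this bound, the lower bound 1 for divisors, and the zero weight of
  the exponents of W.\<close>

locale condition_A =
  fixes lam :: "complex ^ 'n::finite" and G h W :: "('n mfps) ^ 'n" and C :: real
  assumes G_order: "order_ge 2 (G $ k)"
    and G_finite: "finite {\<beta>. mfps_nth (G $ k) \<beta> \<noteq> 0}"
    and h_nonresonant: "mfps_nth (h $ k) \<alpha> \<noteq> 0 \<Longrightarrow> nonresonant lam k \<alpha>"
    and W_resonant: "mfps_nth (W $ i) \<gamma> \<noteq> 0 \<Longrightarrow> \<gamma> \<noteq> 0 \<and> (\<Sum>j\<in>UNIV. of_nat (\<gamma> $ j) * lam $ j) = 0"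
    and divisor_ge_1:
      "nonresonant lam k \<alpha> \<Longrightarrow> 1 \<le> cmod ((\<Sum>i\<in>UNIV. of_nat (\<alpha> $ i) * lam $ i) - lam $ k)"
    and divisor_dominates: "nonresonant lam k \<alpha> \<Longrightarrow>
      cmod (\<Sum>i\<in>UNIV. of_nat (\<alpha> $ i) * mfps_nth (W $ i) \<gamma>)
        \<le> C * cmod ((\<Sum>i\<in>UNIV. of_nat (\<alpha> $ i) * lam $ i) - lam $ k)
            * (\<Sum>i\<in>UNIV. cmod (mfps_nth (W $ i) \<gamma>))"
    and C_nonneg: "0 \<le> C"
    and transforms: "transforms_to (diag_linear lam + G) (\<chi> k. mfps_X k + h $ k)
      (\<chi> k. mfps_const (lam $ k) * mfps_X k + mfps_X k * W $ k)"
begin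

text \<open>The eigenvalue of the linear derivation \<open>\<Sum>i. lam_i x_i d/dx_i\<close> on the
  monomial with exponent \<alpha>.\<close>

definition weight :: "nat ^ 'n \<Rightarrow> complex" where
  "weight \<alpha> = (\<Sum>i\<in>UNIV. of_nat (\<alpha> $ i) * lam $ i)"

definition \<phi> :: "('n mfps) ^ 'n" where
  "\<phi> = (\<chi> k. mfps_X k + h $ k)"

lemma weight_add: "weight (\<alpha> + \<beta>) = weight \<alpha> + weight \<beta>"
  by (simp add: weight_def distrib_right sum.distrib)

lemma weight_axis: "weight (axis k 1) = lam $ k"
proof -
  have "weight (axis k 1) = (\<Sum>i\<in>UNIV. if i = k then lam $ i else 0)"
    unfolding weight_def by (intro sum.cong) (auto simp: axis_def)
  then show ?thesis by simp
qed

lemma h_order: "order_ge 2 (h $ k)"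
  using h_nonresonant by (auto simp: order_ge_def nonresonant_def)

lemma W_order: "order_ge 1 (W $ k)"
  using W_resonant[of k] mdeg_eq_0_iff by (fastforce simp: order_ge_def Suc_le_eq)

lemma \<phi>_order: "order_ge 1 (\<phi> $ k)"
  using h_order[of k]
  by (force simp: order_ge_def \<phi>_def mfps_nth_add mfps_X.rep_eq split: if_splits)

lemma XW_order: "order_ge 2 (mfps_X k * W $ k)"
proof -
  have "order_ge 1 (mfps_X k :: 'n mfps)"
    by (auto simp: order_ge_def mfps_X.rep_eq split: if_splits)
  from order_ge_mult[OF this W_order[of k]] show ?thesis
    by (simp add: numeral_2_eq_2)
qed

text \<open>This is the coefficient at \<alpha> of the transformation identity. The linear part acts
  on h through Euler operators and yields the weight; the terms \<open>x_i W_i\<close> act through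
  the same operators and yield a convolution.\<close>

lemma homological_equation:
  "mfps_nth (mfps_compose (G $ k) \<phi>) \<alpha> =
     mfps_nth (mfps_X k * W $ k) \<alpha> + (weight \<alpha> - lam $ k) * mfps_nth (h $ k) \<alpha> +
     (\<Sum>p | fst p + snd p = \<alpha>. mfps_nth (h $ k) (fst p) *
        (\<Sum>i\<in>UNIV. of_nat (fst p $ i) * mfps_nth (W $ i) (snd p)))"
proof -
  let ?E = "\<lambda>i f. mfps_deriv i f * mfps_X i"
  have \<phi>0: "mfps_nth (\<phi> $ k) 0 = 0"
    using \<phi>_order[of k] by (auto simp: order_ge_def)
  have EX: "?E i (mfps_X k) = (if i = k then mfps_X k else 0)" for i
    by (rule mfps_eqI) (auto simp: mfps_nth_deriv_mult_X mfps_X.rep_eq zero_mfps.rep_eq axis_def)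
  have "mfps_const (lam $ k) * \<phi> $ k + mfps_compose (G $ k) \<phi> = mfps_compose ((diag_linear lam + G) $ k) \<phi>"
    by (simp add: mfps_compose_add mfps_compose_const_mult_X[of \<phi>, OF \<phi>0] diag_linear_def)
  also have "\<dots> = (\<Sum>i\<in>UNIV. mfps_deriv i (\<phi> $ k) * (mfps_const (lam $ i) * mfps_X i + mfps_X i * W $ i))"
    using transforms unfolding transforms_to_def \<phi>_def[symmetric] by simp
  also have "\<dots> = (\<Sum>i\<in>UNIV. (mfps_const (lam $ i) * ?E i (mfps_X k) + ?E i (mfps_X k) * W $ i)
      + (mfps_const (lam $ i) * ?E i (h $ k) + ?E i (h $ k) * W $ i))"
    by (intro sum.cong) (auto simp: \<phi>_def mfps_deriv_add algebra_simps)
  also have "\<dots> = (\<Sum>i\<in>UNIV. (if i = k then mfps_const (lam $ i) * mfps_X k + mfps_X k * W $ i else 0)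
      + (mfps_const (lam $ i) * ?E i (h $ k) + ?E i (h $ k) * W $ i))"
    by (intro sum.cong arg_cong2[where f = "(+)"] refl) (simp add: EX)
  also have "\<dots> = mfps_const (lam $ k) * mfps_X k + mfps_X k * W $ k
      + (\<Sum>i\<in>UNIV. mfps_const (lam $ i) * ?E i (h $ k)) + (\<Sum>i\<in>UNIV. ?E i (h $ k) * W $ i)"
    by (simp add: sum.distrib add.assoc)
  \<comment> \<open>The linear term \<open>lam_k x_k\<close> appears on both sides and is cancelled
    here.\<close>
  finally have "mfps_nth (mfps_const (lam $ k) * h $ k + mfps_compose (G $ k) \<phi>) \<alpha> =
      mfps_nth (mfps_X k * W $ k + (\<Sum>i\<in>UNIV. mfps_const (lam $ i) * ?E i (h $ k))
        + (\<Sum>i\<in>UNIV. ?E i (h $ k) * W $ i)) \<alpha>"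
    by (intro arg_cong[where f = "\<lambda>f. mfps_nth f \<alpha>"]) (simp add: \<phi>_def algebra_simps)
  moreover have "(\<Sum>i\<in>UNIV. mfps_nth (mfps_const (lam $ i) * ?E i (h $ k)) \<alpha>) = weight \<alpha> * mfps_nth (h $ k) \<alpha>"
    unfolding mfps_nth_const_mult mfps_nth_deriv_mult_X weight_def sum_distrib_right
    by (intro sum.cong) auto
  moreover have "(\<Sum>i\<in>UNIV. mfps_nth (?E i (h $ k) * W $ i) \<alpha>) =
     (\<Sum>p | fst p + snd p = \<alpha>. mfps_nth (h $ k) (fst p) *
        (\<Sum>i\<in>UNIV. of_nat (fst p $ i) * mfps_nth (W $ i) (snd p)))"
    unfolding mfps_nth_mult[of "?E _ _"] mfps_nth_deriv_mult_X sum_distrib_left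
    by (subst sum.swap) (simp add: ac_simps)
  ultimately show ?thesis
    unfolding mfps_nth_add mfps_nth_const_mult[of "lam $ k" "h $ k"] mfps_nth_sum by algebra
qed

text \<open>Multiplication by \<open>W\<close> preserves the weight, so all terms of the sum in the homological equation
  carry the divisor that belongs to \<open>\<alpha>\<close> and condition A absorbs the derivatives of \<open>h\<close>.\<close>

lemma coefficient_bound:
  "cmod (mfps_nth (h $ k) \<alpha>) + cmod (mfps_nth (mfps_X k * W $ k) \<alpha>) \<le>
     cmod (mfps_nth (mfps_compose (G $ k) \<phi>) \<alpha>) +
     C * (\<Sum>i\<in>UNIV. cmod (mfps_nth (mfps_abs (h $ k) * mfps_abs (W $ i)) \<alpha>))"
    (is "?h + ?XW \<le> ?G + C * ?S")
proof -
  have S: "0 \<le> C * ?S"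
    by (intro mult_nonneg_nonneg sum_nonneg C_nonneg) auto
  let ?d = "weight \<alpha> - lam $ k"
  let ?V = "\<lambda>p. \<Sum>i\<in>UNIV. of_nat (fst p $ i) * mfps_nth (W $ i) (snd p)"
  let ?D = "{p. fst p + snd p = \<alpha>}"
  have term_bound: "cmod (mfps_nth (h $ k) (fst p) * ?V p) \<le>
      C * cmod ?d * (cmod (mfps_nth (h $ k) (fst p)) * (\<Sum>i\<in>UNIV. cmod (mfps_nth (W $ i) (snd p))))"
    if p: "p \<in> ?D" for p
  proof (cases "mfps_nth (h $ k) (fst p) = 0 \<or> (\<forall>i. mfps_nth (W $ i) (snd p) = 0)")
    case True
    then show ?thesis by auto
  next
    case False
    then obtain i where i: "mfps_nth (W $ i) (snd p) \<noteq> 0" by blast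
    have "weight \<alpha> = weight (fst p)"
      using W_resonant[OF i] p weight_add[of "fst p" "snd p"] by (simp add: weight_def)
    then have "cmod (?V p) \<le> C * cmod ?d * (\<Sum>i\<in>UNIV. cmod (mfps_nth (W $ i) (snd p)))"
      using divisor_dominates[OF h_nonresonant, of k "fst p" "snd p"] False by (simp add: weight_def)
    from mult_left_mono[OF this, of "cmod (mfps_nth (h $ k) (fst p))"] show ?thesis
      by (simp add: norm_mult ac_simps)
  qed
  have "cmod (\<Sum>p\<in>?D. mfps_nth (h $ k) (fst p) * ?V p)
      \<le> (\<Sum>p\<in>?D. C * cmod ?d * (cmod (mfps_nth (h $ k) (fst p)) * (\<Sum>i\<in>UNIV. cmod (mfps_nth (W $ i) (snd p)))))"
    by (rule order.trans[OF norm_sum]) (intro sum_mono term_bound)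
  also have "\<dots> = C * cmod ?d * ?S"
    unfolding cmod_nth_abs_mult sum_distrib_left by (subst sum.swap) simp
  finally have sum_bound: "cmod (\<Sum>p\<in>?D. mfps_nth (h $ k) (fst p) * ?V p) \<le> C * cmod ?d * ?S" .
  \<comment> \<open>At each exponent at most one term on the left survives. If \<open>?d\<close>
    vanishes, h has no term there and \<open>sum_bound\<close> annihilates the convolution;
    otherwise the zero weight of W excludes a term of \<open>x_k W_k\<close>.\<close>
  show ?thesis
  proof (cases "?d = 0")
    case True
    have "mfps_nth (h $ k) \<alpha> = 0"
      using True h_nonresonant[of k \<alpha>] by (auto simp: weight_def nonresonant_def)
    moreover have "mfps_nth (mfps_compose (G $ k) \<phi>) \<alpha> = mfps_nth (mfps_X k * W $ k) \<alpha>"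
      using True sum_bound homological_equation[of k \<alpha>] by simp
    ultimately show ?thesis
      using S by simp
  next
    case False
    have XW: "mfps_nth (mfps_X k * W $ k) \<alpha> = 0"
    proof (rule ccontr)
      assume "mfps_nth (mfps_X k * W $ k) \<alpha> \<noteq> 0"
      then obtain \<gamma> where "\<alpha> = axis k 1 + \<gamma>" "mfps_nth (W $ k) \<gamma> \<noteq> 0"
        unfolding mfps_X_eq_monom by (rule mfps_nth_monom_mult_neq_0)
      then have "weight \<alpha> = lam $ k"
        using W_resonant[of k \<gamma>] unfolding weight_def[symmetric] by (simp only: weight_add weight_axis) simp
      with False show False by simp
    qed
    show ?thesis
    proof (cases "mfps_nth (h $ k) \<alpha> = 0")
      case True
      with XW S show ?thesis by simp
    next
      case h: False
      \<comment> \<open>A divisor of modulus at least 1 may be inserted in front of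
        \<open>?G\<close>; the entire inequality then carries this factor and can be divided by
        it.\<close>
      have d: "1 \<le> cmod ?d"
        using divisor_ge_1[OF h_nonresonant[OF h]] by (simp add: weight_def)
      have "?d * mfps_nth (h $ k) \<alpha> = mfps_nth (mfps_compose (G $ k) \<phi>) \<alpha>
          - (\<Sum>p\<in>?D. mfps_nth (h $ k) (fst p) * ?V p)"
        using homological_equation[of k \<alpha>] XW by simp
      then have "cmod ?d * ?h \<le> ?G + C * cmod ?d * ?S"
        unfolding norm_mult[symmetric] using sum_bound
        by (smt (verit) norm_triangle_ineq4)
      also have "\<dots> \<le> cmod ?d * ?G + C * cmod ?d * ?S"
        using mult_right_mono[OF d, of ?G] by simp
      also have "\<dots> = cmod ?d * (?G + C * ?S)"
        by (simp add: algebra_simps)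
      finally have "?h \<le> ?G + C * ?S"
        by (rule mult_left_le_imp_le) (use d in linarith)
      with XW show ?thesis by simp
    qed
  qed
qed

text \<open>Transformation and normal form are estimated together because each feeds the bound for
  the other. The products \<open>x_k W_k\<close> are used so that all summands have order at least 2
  and the majorant starts from 0 in degree 1.\<close>

definition majorant :: "real \<Rightarrow> nat \<Rightarrow> real" where
  "majorant r n = (\<Sum>k\<in>UNIV. trunc_norm r n (h $ k) + trunc_norm r n (mfps_X k * W $ k))"

definition G_norm :: real where
  "G_norm = (\<Sum>k\<in>UNIV. \<Sum>\<beta> | mfps_nth (G $ k) \<beta> \<noteq> 0. cmod (mfps_nth (G $ k) \<beta>))"

lemma trunc_norm_le_majorant:
  assumes "0 \<le> r"
  shows "trunc_norm r n (h $ k) \<le> majorant r n"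
    and "trunc_norm r n (mfps_X k * W $ k) \<le> majorant r n"
proof -
  have "trunc_norm r n (h $ k) + trunc_norm r n (mfps_X k * W $ k) \<le> majorant r n"
    unfolding majorant_def
    by (rule member_le_sum) (auto intro: add_nonneg_nonneg trunc_norm_nonneg assms)
  then show "trunc_norm r n (h $ k) \<le> majorant r n"
    and "trunc_norm r n (mfps_X k * W $ k) \<le> majorant r n"
    using trunc_norm_nonneg[OF assms, of n "h $ k"]
      trunc_norm_nonneg[OF assms, of n "mfps_X k * W $ k"] by linarith+
qed

lemma majorant_nonneg: "0 \<le> r \<Longrightarrow> 0 \<le> majorant r n"
  by (simp add: majorant_def sum_nonneg trunc_norm_nonneg)

lemma majorant_1: "majorant r 1 = 0"
proof -
  have "trunc_norm r 1 f = 0" if "order_ge 2 f" for f :: "'n mfps"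
    unfolding trunc_norm_def using that by (intro sum.neutral) (force simp: order_ge_def)
  then show ?thesis
    by (simp add: majorant_def h_order XW_order)
qed

text \<open>Summing \<open>coefficient_bound\<close> over exponents leaves products that, by the
  orders of their factors, involve only data of one degree less. The quotient by r comes from
  replacing W by \<open>x_i W_i\<close>.\<close>

lemma majorant_recursion:
  assumes r: "0 < r" and small: "r + majorant r (Suc n) \<le> 1"
  shows "majorant r (Suc (Suc n)) \<le>
    G_norm * (r + majorant r (Suc n))\<^sup>2 + C * ((majorant r (Suc n))\<^sup>2 / r)"
proof -
  have r0: "0 \<le> r" using r by simp
  let ?N = "Suc (Suc n)" and ?M = "majorant r (Suc n)"
  let ?K = "\<lambda>k. \<Sum>\<beta> | mfps_nth (G $ k) \<beta> \<noteq> 0. cmod (mfps_nth (G $ k) \<beta>)"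
  have \<phi>: "trunc_norm r (Suc n) (\<phi> $ i) \<le> r + ?M" for i
    unfolding \<phi>_def vec_lambda_beta
    using trunc_norm_triangle[OF r0, of "Suc n" "mfps_X i" "h $ i"] trunc_norm_X_le[OF r0, of "Suc n" i]
      trunc_norm_le_majorant(1)[OF r0, of "Suc n" i] by linarith
  have W: "trunc_norm r n (W $ i) \<le> trunc_norm r (Suc n) (mfps_X i * W $ i) / r" for i
    using trunc_norm_monom_mult[OF r0, of "axis i 1" n "W $ i"] r
    by (simp add: mfps_X_eq_monom field_simps)
  have one: "trunc_norm r ?N (h $ k) + trunc_norm r ?N (mfps_X k * W $ k) \<le>
      ?K k * (r + ?M)\<^sup>2 + C * (trunc_norm r (Suc n) (h $ k) * (?M / r))" for k
  proof -
    have "trunc_norm r ?N (h $ k) + trunc_norm r ?N (mfps_X k * W $ k) \<le>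
      (\<Sum>\<alpha> | mdeg \<alpha> \<le> ?N. (cmod (mfps_nth (mfps_compose (G $ k) \<phi>) \<alpha>) +
         C * (\<Sum>i\<in>UNIV. cmod (mfps_nth (mfps_abs (h $ k) * mfps_abs (W $ i)) \<alpha>))) * r ^ mdeg \<alpha>)"
      unfolding trunc_norm_def sum.distrib[symmetric] distrib_right[symmetric]
      by (intro sum_mono mult_right_mono coefficient_bound) (use r0 in auto)
    also have "\<dots> = trunc_norm r ?N (mfps_compose (G $ k) \<phi>) +
        C * (\<Sum>i\<in>UNIV. trunc_norm r ?N (mfps_abs (h $ k) * mfps_abs (W $ i)))"
      unfolding trunc_norm_def distrib_right sum.distrib
      by (simp add: sum_distrib_left sum_distrib_right mult.assoc sum.swap[of _ UNIV])
    also have "\<dots> \<le> ?K k * (r + ?M)\<^sup>2 + C * (trunc_norm r (Suc n) (h $ k) * (?M / r))"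
    proof (intro add_mono mult_left_mono C_nonneg)
      show "trunc_norm r ?N (mfps_compose (G $ k) \<phi>) \<le> ?K k * (r + ?M)\<^sup>2"
        by (rule trunc_norm_compose_Suc[OF r0 \<phi> small \<phi>_order G_order G_finite]) auto
      have "(\<Sum>i\<in>UNIV. trunc_norm r ?N (mfps_abs (h $ k) * mfps_abs (W $ i)))
          \<le> (\<Sum>i\<in>UNIV. trunc_norm r (Suc n) (h $ k) * (trunc_norm r (Suc n) (mfps_X i * W $ i) / r))"
      proof (rule sum_mono)
        fix i
        \<comment> \<open>Here h has order 2 and W has order 1, so degree n + 2 of the product needs
          h up to n + 1 and W up to n; the latter corresponds to \<open>x_i W_i\<close> up to n +
          1.\<close>
        have "trunc_norm r ?N (mfps_abs (h $ k) * mfps_abs (W $ i))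
            \<le> trunc_norm r (Suc n) (h $ k) * trunc_norm r n (W $ i)"
          using trunc_norm_mult[OF r0, of 2 "mfps_abs (h $ k)" 1 "mfps_abs (W $ i)" ?N]
          using h_order[of k] W_order[of i] by simp
        also have "\<dots> \<le> trunc_norm r (Suc n) (h $ k) * (trunc_norm r (Suc n) (mfps_X i * W $ i) / r)"
          by (intro mult_left_mono W trunc_norm_nonneg r0)
        finally show "trunc_norm r ?N (mfps_abs (h $ k) * mfps_abs (W $ i)) \<le> \<dots>" .
      qed
      also have "\<dots> = trunc_norm r (Suc n) (h $ k) * ((\<Sum>i\<in>UNIV. trunc_norm r (Suc n) (mfps_X i * W $ i)) / r)"
        by (simp add: sum_distrib_left sum_divide_distrib)
      also have "\<dots> \<le> trunc_norm r (Suc n) (h $ k) * (?M / r)"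
        unfolding majorant_def
        by (intro mult_left_mono divide_right_mono sum_mono trunc_norm_nonneg r0)
           (simp add: trunc_norm_nonneg r0)
      finally show "(\<Sum>i\<in>UNIV. trunc_norm r ?N (mfps_abs (h $ k) * mfps_abs (W $ i)))
          \<le> trunc_norm r (Suc n) (h $ k) * (?M / r)" .
    qed
    finally show ?thesis .
  qed
  have "majorant r ?N \<le> (\<Sum>k\<in>UNIV. ?K k * (r + ?M)\<^sup>2 + C * (trunc_norm r (Suc n) (h $ k) * (?M / r)))"
    unfolding majorant_def[of r ?N] by (intro sum_mono one)
  also have "\<dots> = G_norm * (r + ?M)\<^sup>2 + C * ((\<Sum>k\<in>UNIV. trunc_norm r (Suc n) (h $ k)) * (?M / r))"
    by (simp add: G_norm_def sum.distrib sum_distrib_right sum_distrib_left sum_divide_distrib)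
  also have "\<dots> \<le> G_norm * (r + ?M)\<^sup>2 + C * (?M * (?M / r))"
  proof (intro add_left_mono mult_left_mono mult_right_mono C_nonneg)
    show "(\<Sum>k\<in>UNIV. trunc_norm r (Suc n) (h $ k)) \<le> ?M"
      unfolding majorant_def by (intro sum_mono) (simp add: trunc_norm_nonneg r0)
    show "0 \<le> ?M / r"
      using majorant_nonneg[OF r0] r by simp
  qed
  finally show ?thesis
    by (simp add: power2_eq_square)
qed

text \<open>For suitable \<epsilon> and r the recursion reproduces the bound \<epsilon> r, so all
  truncated norms stay bounded at one fixed radius.\<close>

theorem normal_form_convergent:
  "mfps_convergent (mfps_const (lam $ k) * mfps_X k + mfps_X k * W $ k)"
proof -
  \<comment> \<open>The constants make each of the two contributions to the recursion at most half
    of \<epsilon> r: the choice of \<epsilon> gives C \<epsilon> \<le> 1/2, and that of r gives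
    \<open>4 * G_norm * r \<le> \<epsilon> / 2\<close>.\<close>
  define \<epsilon> where "\<epsilon> = 1 / (2 * (C + 1))"
  define r where "r = \<epsilon> / (8 * (G_norm + 1))"
  have G: "0 \<le> G_norm"
    by (simp add: G_norm_def sum_nonneg)
  have \<epsilon>: "0 < \<epsilon>" "\<epsilon> \<le> 1/2" "C * \<epsilon> \<le> 1/2"
    using C_nonneg by (auto simp: \<epsilon>_def field_simps)
  have r: "0 < r" "4 * G_norm * r \<le> \<epsilon> / 2"
    using \<epsilon>(1) G by (auto simp: r_def field_simps)
  have "r \<le> \<epsilon> / 8"
    unfolding r_def using \<epsilon>(1) G by (intro divide_left_mono) auto
  with \<epsilon> have r1: "r \<le> 1/2"
    by simp
  have bound: "majorant r (Suc n) \<le> \<epsilon> * r" for n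
  proof (induction n)
    case 0
    show ?case
      using majorant_1[of r] \<epsilon> r by simp
  next
    case (Suc n)
    let ?M = "majorant r (Suc n)"
    have M0: "0 \<le> ?M"
      using majorant_nonneg r by simp
    \<comment> \<open>Together with r \<le> 1/2 this gives r + \<open>?M\<close> \<le> 2 r \<le> 1,
      the smallness required by the recursion.\<close>
    have Mr: "?M \<le> r"
      using Suc mult_right_mono[of \<epsilon> 1 r] \<epsilon> r by linarith
    have "majorant r (Suc (Suc n)) \<le> G_norm * (r + ?M)\<^sup>2 + C * (?M\<^sup>2 / r)"
      by (rule majorant_recursion) (use r Mr r1 in auto)
    also have "\<dots> \<le> G_norm * (2 * r)\<^sup>2 + C * ((\<epsilon> * r)\<^sup>2 / r)"
      by (intro add_mono mult_left_mono divide_right_mono power_mono G C_nonneg Suc)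
         (use M0 Mr r in auto)
    also have "\<dots> = (4 * G_norm * r) * r + (C * \<epsilon>) * (\<epsilon> * r)"
      using r by (simp add: power2_eq_square)
    also have "\<dots> \<le> (\<epsilon> / 2) * r + (1/2) * (\<epsilon> * r)"
      by (intro add_mono mult_right_mono r \<epsilon>) (use r \<epsilon> in auto)
    finally show ?case
      by simp
  qed
  show ?thesis
  proof (rule mfps_convergentI[OF r(1)])
    fix n
    have r0: "0 \<le> r" using r by simp
    \<comment> \<open>The induction covers degrees n + 1 only; monotonicity includes degree
      0.\<close>
    have "trunc_norm r n (mfps_X k * W $ k) \<le> trunc_norm r (Suc n) (mfps_X k * W $ k)"
      by (rule trunc_norm_mono[OF r0]) simp
    also have "\<dots> \<le> \<epsilon> * r"
      by (rule order.trans[OF trunc_norm_le_majorant(2)[OF r0] bound])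
    finally have "trunc_norm r n (mfps_X k * W $ k) \<le> \<epsilon> * r" .
    moreover have "trunc_norm r n (mfps_const (lam $ k) * mfps_X k) \<le> cmod (lam $ k) * r"
      unfolding trunc_norm_const_mult by (intro mult_left_mono trunc_norm_X_le r0) simp
    ultimately show "trunc_norm r n (mfps_const (lam $ k) * mfps_X k + mfps_X k * W $ k)
        \<le> cmod (lam $ k) * r + \<epsilon> * r"
      using trunc_norm_triangle[OF r0, of n "mfps_const (lam $ k) * mfps_X k" "mfps_X k * W $ k"]
      by linarith
  qed
qed

end

section \<open>The three-dimensional system\<close>

definition supported_on :: "(nat ^ 'n::finite) set \<Rightarrow> 'n mfps \<Rightarrow> bool" where
  "supported_on B f \<longleftrightarrow> (\<forall>\<beta>. mfps_nth f \<beta> \<noteq> 0 \<longrightarrow> \<beta> \<in> B)"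

lemma supported_on_monom_sum:
  "supported_on (e ` S) (\<Sum>s\<in>S. mfps_const (c s) * mfps_monom (e s))"
  unfolding supported_on_def
proof safe
  fix \<beta> assume "mfps_nth (\<Sum>s\<in>S. mfps_const (c s) * mfps_monom (e s)) \<beta> \<noteq> 0"
  then have "(\<Sum>s\<in>S. c s * mfps_nth (mfps_monom (e s)) \<beta>) \<noteq> 0"
    by (simp add: mfps_nth_sum mfps_nth_const_mult)
  then obtain s where "s \<in> S" "c s * mfps_nth (mfps_monom (e s)) \<beta> \<noteq> 0"
    by (rule sum.not_neutral_contains_not_neutral)
  then show "\<beta> \<in> e ` S"
    by (auto simp: mfps_monom.rep_eq split: if_splits)
qed

lemma supported_on_const_mult: "supported_on B f \<Longrightarrow> supported_on B (mfps_const c * f)"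
  by (auto simp: supported_on_def mfps_nth_const_mult)

lemma X_powers_eq_monom:
  "mfps_X 1 ^ p * mfps_X 2 ^ q * mfps_X 3 ^ r = (mfps_monom (vector [p, q, r]) :: 3 mfps)"
  unfolding mfps_X_eq_monom mfps_monom_power mfps_monom_add[symmetric]
  by (rule arg_cong[where f = mfps_monom]) (simp add: vec_eq_iff forall_3 axis_def)

text \<open>Powers of \<open>x1 x2 x3\<close> are the monomials with three equal exponents, and the
  missing constant term of Y excludes exponent 0.\<close>

lemma fps_compose_X123_nth_neq_0:
  assumes "mfps_nth (fps_mfps_compose Y (mfps_X 1 * mfps_X 2 * mfps_X 3 :: 3 mfps)) \<gamma> \<noteq> 0"
    and "fps_nth Y 0 = 0"
  obtains j where "j > 0" "\<gamma> = vector [j, j, j]"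
proof -
  have "(mfps_X 1 * mfps_X 2 * mfps_X 3 :: 3 mfps) ^ j = mfps_monom (vector [j, j, j])" for j
    by (simp add: power_mult_distrib X_powers_eq_monom)
  then have "(\<Sum>j\<le>mdeg \<gamma>. fps_nth Y j * mfps_nth (mfps_monom (vector [j, j, j])) \<gamma>) \<noteq> 0"
    using assms(1) by (simp add: fps_mfps_compose_def Abs_mfps_inverse)
  then obtain j where "fps_nth Y j * mfps_nth (mfps_monom (vector [j, j, j])) \<gamma> \<noteq> 0"
    by (rule sum.not_neutral_contains_not_neutral)
  with assms(2) show ?thesis
    by (intro that[of j]) (auto simp: mfps_monom.rep_eq intro: gr0I split: if_splits)
qed

lemma fps_mfps_compose_add:
  "fps_mfps_compose (Y + Z) w = fps_mfps_compose Y w + fps_mfps_compose Z w"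
  by (rule mfps_eqI)
     (simp add: fps_mfps_compose_def Abs_mfps_inverse mfps_nth_add distrib_right sum.distrib)

lemma fps_mfps_compose_0: "fps_mfps_compose 0 w = 0"
  by (rule mfps_eqI) (simp add: fps_mfps_compose_def Abs_mfps_inverse zero_mfps.rep_eq)

lemma mdeg_3: "mdeg (\<alpha> :: nat ^ 3) = \<alpha> $ 1 + \<alpha> $ 2 + \<alpha> $ 3"
  by (simp add: mdeg_def sum_3)

theorem theorem3:
  fixes \<zeta> :: complex
    and S :: "(int \<times> nat \<times> nat) set"
    and a :: "int \<Rightarrow> nat \<Rightarrow> nat \<Rightarrow> complex"
    and b :: "nat \<Rightarrow> int \<Rightarrow> nat \<Rightarrow> complex"
    and c :: "nat \<Rightarrow> nat \<Rightarrow> int \<Rightarrow> complex"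
    and Y1 Y2 Y3 :: "complex fps"
  assumes "\<zeta> ^ 3 = 1" and "\<zeta> \<noteq> 1"
    and "finite S"
    and "\<And>p q r. (p, q, r) \<in> S \<Longrightarrow> p \<ge> -1 \<and> p + int q + int r \<ge> 1"
    and "fps_nth Y1 0 = 0" and "fps_nth Y2 0 = 0" and "fps_nth Y3 0 = 0"
    and "distinguished_normal_form (vector [1, \<zeta>, \<zeta>\<^sup>2])
           (resonant_system \<zeta> S a b c) (normal_form_system \<zeta> Y1 Y2 Y3)"
    and "Y1 + Y2 + Y3 = 0"
  shows "\<forall>k. mfps_convergent (normal_form_system \<zeta> Y1 Y2 Y3 $ k)"
proof -
  define lam :: "complex ^ 3" where "lam = vector [1, \<zeta>, \<zeta>\<^sup>2]"
  define w :: "3 mfps" where "w = mfps_X 1 * mfps_X 2 * mfps_X 3"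
  define W :: "(3 mfps) ^ 3" where
    "W = vector [fps_mfps_compose Y1 w, fps_mfps_compose Y2 w, fps_mfps_compose Y3 w]"
  define G where "G = resonant_system \<zeta> S a b c - diag_linear lam"
  have \<zeta>: "1 + \<zeta> + \<zeta>\<^sup>2 = 0"
    by (rule primitive_cube_root) (fact assms)+
  have const_1: "mfps_const 1 = (1 :: 3 mfps)"
    by (rule mfps_eqI) (simp add: mfps_const.rep_eq one_mfps.rep_eq)
  have N: "normal_form_system \<zeta> Y1 Y2 Y3 =
      (\<chi> k. mfps_const (lam $ k) * mfps_X k + mfps_X k * W $ k)"
    by (simp add: vec_eq_iff forall_3 normal_form_system_def lam_def W_def w_def Let_def const_1)
  obtain h where h: "distinguished_normalizing_transformation lam (resonant_system \<zeta> S a b c) h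
      (normal_form_system \<zeta> Y1 Y2 Y3)"
    using assms(8) by (auto simp: distinguished_normal_form_def lam_def)
  \<comment> \<open>One finite set holds the exponents of all three equations, which permute the
    triple cyclically; constant factors such as \<zeta> do not enlarge the support.\<close>
  define B where "B = (\<lambda>(p, q, r). vector [nat (p + 1), q, r] :: nat ^ 3) ` S \<union>
    (\<lambda>(p, q, r). vector [r, nat (p + 1), q]) ` S \<union> (\<lambda>(p, q, r). vector [q, r, nat (p + 1)]) ` S"
  have "supported_on ((\<lambda>(p, q, r). vector [nat (p + 1), q, r]) ` S) (G $ 1)"
    using supported_on_monom_sum[of "\<lambda>(p, q, r). vector [nat (p + 1), q, r]" S "\<lambda>(p, q, r). a p q r"]
    by (simp add: G_def resonant_system_def diag_linear_def lam_def Let_def const_1 case_prod_unfold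
        mult.assoc X_powers_eq_monom[unfolded mult.assoc])
  moreover have "supported_on ((\<lambda>(p, q, r). vector [r, nat (p + 1), q]) ` S) (G $ 2)"
    using supported_on_const_mult[OF supported_on_monom_sum[of
        "\<lambda>(p, q, r). vector [r, nat (p + 1), q]" S "\<lambda>(p, q, r). b r p q"], of \<zeta>]
    by (simp add: G_def resonant_system_def diag_linear_def lam_def Let_def case_prod_unfold
        mult.assoc X_powers_eq_monom[unfolded mult.assoc] distrib_left)
  moreover have "supported_on ((\<lambda>(p, q, r). vector [q, r, nat (p + 1)]) ` S) (G $ 3)"
    using supported_on_const_mult[OF supported_on_monom_sum[of
        "\<lambda>(p, q, r). vector [q, r, nat (p + 1)]" S "\<lambda>(p, q, r). c q r p"], of "\<zeta>\<^sup>2"]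
    by (simp add: G_def resonant_system_def diag_linear_def lam_def Let_def case_prod_unfold
        mult.assoc X_powers_eq_monom[unfolded mult.assoc] distrib_left)
  ultimately have "\<forall>k. supported_on B (G $ k)"
    by (auto simp: forall_3 supported_on_def B_def)
  then have G_support: "\<beta> \<in> B" if "mfps_nth (G $ k) \<beta> \<noteq> 0" for k \<beta>
    using that by (simp add: supported_on_def)
  have B: "finite B"
    using assms(3) by (simp add: B_def)
  \<comment> \<open>Because p \<ge> -1, the entry nat (p + 1) is exactly p + 1, and the degree is p
    + q + r + 1.\<close>
  have B_deg: "2 \<le> mdeg \<beta>" if "\<beta> \<in> B" for \<beta>
    using that by (auto simp: B_def mdeg_3 dest!: assms(4))
  have weight_eq: "(\<Sum>i\<in>UNIV. of_nat (\<alpha> $ i) * lam $ i) =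
      of_int (int (\<alpha> $ 1)) + of_int (int (\<alpha> $ 2)) * \<zeta> + of_int (int (\<alpha> $ 3)) * \<zeta>\<^sup>2" for \<alpha>
    by (simp add: sum_3 lam_def)
  \<comment> \<open>Each eigenvalue is written as the weight of a unit exponent, so that a divisor
    becomes an integer combination of powers of \<zeta>. Its coefficients may be negative, hence the
    integers.\<close>
  have lam_eq: "lam $ k = of_int (int (axis k 1 $ 1)) + of_int (int (axis k 1 $ 2)) * \<zeta>
      + of_int (int (axis k 1 $ 3)) * \<zeta>\<^sup>2" for k
    using exhaust_3[of k] by (auto simp: lam_def axis_def)
  have divisor_eq: "(\<Sum>i\<in>UNIV. of_nat (\<alpha> $ i) * lam $ i) - lam $ k =
      of_int (int (\<alpha> $ 1) - int (axis k 1 $ 1)) + of_int (int (\<alpha> $ 2) - int (axis k 1 $ 2)) * \<zeta>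
      + of_int (int (\<alpha> $ 3) - int (axis k 1 $ 3)) * \<zeta>\<^sup>2" for \<alpha> k
    unfolding weight_eq lam_eq[of k] by (simp add: algebra_simps)
  have divisor: "1 \<le> cmod ((\<Sum>i\<in>UNIV. of_nat (\<alpha> $ i) * lam $ i) - lam $ k)"
    if "nonresonant lam k \<alpha>" for \<alpha> k
  proof -
    have "1 \<le> cmod (of_int l + of_int m * \<zeta> + of_int n * \<zeta>\<^sup>2)"
      if "of_int l + of_int m * \<zeta> + of_int n * \<zeta>\<^sup>2 \<noteq> 0" for l m n :: int
    proof -
      have "of_int l + of_int m * \<zeta> + of_int n * \<zeta>\<^sup>2 = of_int (l - n) + of_int (m - n) * \<zeta>"
        using \<zeta> unfolding of_int_diff by algebra
      with that show ?thesis
        using cmod_eisenstein_ge_1[OF \<zeta>, of "l - n" "m - n"] by metis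
    qed
    with that show ?thesis
      unfolding nonresonant_def divisor_eq by blast
  qed
  \<comment> \<open>The vanishing of Y1 + Y2 + Y3 enters here, coefficient by coefficient.\<close>
  have W_sum: "mfps_nth (W $ 1) \<gamma> + mfps_nth (W $ 2) \<gamma> + mfps_nth (W $ 3) \<gamma> = 0" for \<gamma>
    using assms(9)
    by (simp add: W_def mfps_nth_add[symmetric] fps_mfps_compose_add[symmetric] fps_mfps_compose_0
        zero_mfps.rep_eq)
  \<comment> \<open>The constant 3 is 2 + 1: the factor 2 of
    \<open>cmod_combination_le_eisenstein\<close>, plus 1 for the leftover term \<open>?w k\<close>,
    which a divisor of modulus at least 1 absorbs.\<close>
  interpret condition_A lam G h W 3
  proof
    fix k \<alpha> \<gamma>
    show "order_ge 2 (G $ k)"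
      using G_support B_deg by (auto simp: order_ge_def)
    show "finite {\<beta>. mfps_nth (G $ k) \<beta> \<noteq> 0}"
      by (rule finite_subset[OF _ B]) (auto intro: G_support)
    show "nonresonant lam k \<alpha>" if "mfps_nth (h $ k) \<alpha> \<noteq> 0"
      using h that by (auto simp: distinguished_normalizing_transformation_def)
    show "\<gamma> \<noteq> 0 \<and> (\<Sum>j\<in>UNIV. of_nat (\<gamma> $ j) * lam $ j) = 0" if "mfps_nth (W $ k) \<gamma> \<noteq> 0"
    proof -
      obtain Y where "W $ k = fps_mfps_compose Y w" "fps_nth Y 0 = 0"
        using exhaust_3[of k] assms(5-7) by (auto simp: W_def)
      with that obtain j where j: "j > 0" "\<gamma> = vector [j, j, j]"
        unfolding w_def by (metis fps_compose_X123_nth_neq_0)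
      have "(\<Sum>i\<in>UNIV. of_nat (\<gamma> $ i) * lam $ i) = of_nat j * (1 + \<zeta> + \<zeta>\<^sup>2)"
        unfolding weight_eq by (simp add: j algebra_simps)
      moreover have "\<gamma> \<noteq> 0"
        using j by (auto simp: vec_eq_iff forall_3)
      ultimately show ?thesis
        using \<zeta> by simp
    qed
    show "transforms_to (diag_linear lam + G) (\<chi> k. mfps_X k + h $ k)
        (\<chi> k. mfps_const (lam $ k) * mfps_X k + mfps_X k * W $ k)"
      using h by (simp add: distinguished_normalizing_transformation_def normalizing_transformation_def
          N G_def)
    assume nonres: "nonresonant lam k \<alpha>"
    show "1 \<le> cmod ((\<Sum>i\<in>UNIV. of_nat (\<alpha> $ i) * lam $ i) - lam $ k)"
      by (rule divisor[OF nonres])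
    let ?d = "cmod ((\<Sum>i\<in>UNIV. of_nat (\<alpha> $ i) * lam $ i) - lam $ k)"
    let ?w = "\<lambda>i. mfps_nth (W $ i) \<gamma>"
    let ?n = "\<Sum>i\<in>UNIV. cmod (?w i)"
    have n: "?n = cmod (?w 1) + cmod (?w 2) + cmod (?w 3)"
      by (simp add: sum_3)
    \<comment> \<open>Subtracting the k-th unit exponent gives the same integer coefficients as in
      the divisor, so the two combinations become comparable.\<close>
    let ?v = "\<lambda>i. of_int (int (\<alpha> $ i) - int (axis k 1 $ i))"
    have "(\<Sum>i\<in>UNIV. of_nat (\<alpha> $ i) * ?w i) = (?v 1 * ?w 1 + ?v 2 * ?w 2 + ?v 3 * ?w 3) + ?w k"
      using exhaust_3[of k] by (auto simp: sum_3 axis_def algebra_simps)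
    also have "cmod \<dots> \<le> 2 * ?d * ?n + ?n"
      unfolding divisor_eq n
      by (intro order.trans[OF norm_triangle_ineq] add_mono cmod_combination_le_eisenstein \<zeta> W_sum)
         (use exhaust_3[of k] in auto)
    also have "2 * ?d * ?n + ?n \<le> 2 * ?d * ?n + ?d * ?n"
      using mult_right_mono[OF divisor[OF nonres], of ?n] by (simp add: sum_nonneg mult.commute)
    finally show "cmod (\<Sum>i\<in>UNIV. of_nat (\<alpha> $ i) * ?w i) \<le> 3 * ?d * ?n"
      by (simp add: algebra_simps)
  qed simp
  show ?thesis
    unfolding N by (simp add: normal_form_convergent)
qed


end
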